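(* Let $\mathcal{U}^{F,n}_{D,Q,\mathcal{P}}$ be a kernel-type Chudnovsky$^2$ multiplication algorithm in $\mathbb{F}_{q^n}$ with basis $\mathcal{B}_{2D}=\mathcal{B}_D\cup\mathcal{B}_D^c$ of $\mathcal{L}(2D)$. Define $$\mu^{opti}_{s,0}(\mathcal{U}^{F,n}_{D,Q,\mathcal{P}}):=\min_{\sigma\in GL_{\mathbb{F}_q}(n)}\mu_{s,0}(\mathcal{U}^{F,n}_{\sigma(D),Q,\mathcal{P}}),$$ where $\mathcal{U}^{F,n}_{\sigma(D),Q,\mathcal{P}}$ is the algorithm obtained by using the basis $\sigma(\mathcal{B}_D)$ of $\mathcal{L}(D)$, the basis $\sigma(\mathcal{B}_D)\cup\mathcal{B}_D^c$ of $\mathcal{L}(2D)$ and the basis $\mathcal{B}_Q=Ev_Q(\sigma(\mathcal{B}_D))$ of $F_Q$. For $\sigma\in GL_{\mathbb{F}_q}(n)$ let $T_{\sigma(D)}$ be the matrix of $Ev_{\mathcal{P}}|_{\mathcal{L}(D)}$ in the basis $\sigma(\mathcal{B}_D)$, and let $T^{-1}_{2\sigma(D),n}$ be the matrix formed by the first $n$ rows of the inverse of the matrix of $Ev_{\mathcal{P}}$ in the basis $\sigma(\mathcal{B}_D)\cup\mathcal{B}_D^c$. Then the minimum is reached for $\{\mathcal{B}_{D,max},\mathcal{B}_Q\}$, where $\mathcal{B}_{D,max}$ is a basis $\sigma(\mathcal{B}_D)$ of $\mathcal{L}(D)$ for which $2N_z(T_{\sigma(D)})+N_z(T^{-1}_{2\sigma(D),n})$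 is maximal over $\sigma\in GL_{\mathbb{F}_q}(n)$, and $\mathcal{B}_Q=Ev_Q(\mathcal{B}_{D,max})$. In particular $$\mu^{opti}_{s,0}(\mathcal{U}^{F,n}_{D,Q,\mathcal{P}})=3n(2n+g-1)-N_{z,max},\qquad N_{z,max}=\max_{\sigma\in GL_{\mathbb{F}_q}(n)}\bigl\{2N_z(T_{\sigma(D)})+N_z(T^{-1}_{2\sigma(D),n})\bigr\}.$$
   Context: Setting. $q$ is a prime power, $n\ge 1$ an integer, $F/\mathbb{F}_q$ an algebraic function field of genus $g$, $Q$ a place of $F/\mathbb{F}_q$ of degree $n$ with valuation ring $\mathcal{O}_Q$ and residue class field $F_Q=\mathcal{O}_Q/Q\cong\mathbb{F}_{q^n}$, $D$ a divisor of $F/\mathbb{F}_q$, and $\mathcal{P}=\{P_1,\dots,P_N\}$ an ordered set of distinct places of degree one. $\mathcal{L}(D)$ denotes the Riemann–Roch space of $D$. It is assumed that the support of $D$ contains none of $Q,P_1,\dots,P_N$, that $Ev_Q:\mathcal{L}(D)\to F_Q$, $f\mapsto f(Q)$, is surjective, and that $Ev_{\mathcal{P}}:\mathcal{L}(2D)\to\mathbb{F}_q^N$, $f\mapsto(f(P_1),\dots,f(P_N))$, is injective. In addition, $D$ is effective, $D-Q$ is a non-special divisor of degree $g-1$, and $N=|\mathcal{P}|=\dim\mathcal{L}(2D)$. Consequently $Ev_Q$ and $Ev_{\mathcal{P}}$ are isomorphisms, $\mathcal{L}(D)\subseteq\mathcal{L}(2D)\subseteq\mathcal{O}_Q$, $\dim\mathcal{L}(D)=n$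 and $N=2n+g-1$. Let $E_Q:\mathcal{O}_Q\to F_Q$ be the canonical projection. The Chudnovsky$^2$ multiplication algorithm $\mathcal{U}^{F,n}_{D,Q,\mathcal{P}}$ computes $xy=\mathcal{U}^R(\mathcal{U}^A(x)\odot\mathcal{U}^A(y))$ for $x,y\in F_Q$, with $\odot$ the coordinatewise product, $\mathcal{U}^{A}:=Ev_{\mathcal{P}}|_{\mathcal{L}(D)}\circ Ev_Q^{-1}$ and $\mathcal{U}^{R}:=E_Q|_{\mathcal{L}(2D)}\circ Ev_{\mathcal{P}}^{-1}$. Kernel-type: the algorithm is kernel-type if the (ordered) basis of $\mathcal{L}(2D)$ used is $\mathcal{B}_{2D}=\mathcal{B}_D\cup\mathcal{B}_D^c$, with first $n$ elements $\mathcal{B}_D=\{f_1,\dots,f_n\}$ a basis of $\mathcal{L}(D)$ and last $N-n$ elements $\mathcal{B}_D^c$ a basis of $\ker(E_Q|_{\mathcal{L}(2D)})$, which is a complement of $\mathcal{L}(D)$ in $\mathcal{L}(2D)$. Matrices. $\mathbb{F}_q^N$ has its canonical basis. $T_{2D}$ is the matrix of $Ev_{\mathcal{P}}$ in the basis $\mathcal{B}_{2D}$; $T_D$ is the matrix of the first $n$ columns of $T_{2D}$, i.e. the matrix of $Ev_{\mathcal{P}}|_{\mathcal{L}(D)}$ in the basis $\mathcal{B}_D$; $C$ is the matrix of $E_Q|_{\mathcal{L}(2D)}$ in the bases $\mathcal{B}_{2D}$, $\mathcal{B}_Q$. $N_z(M)$ is the number of zero entries of a matrix $M$. For $\sigma=(\sigma_{ij})\in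 GL_{\mathbb{F}_q}(n)$, $\sigma(\mathcal{B}_D)$ is the basis with $j$-th element $\sum_i\sigma_{ij}f_i$. Scalar complexities (counting only savings due to zero entries), for the algorithm with bases $\mathcal{B}_{2D}$ and $\mathcal{B}_Q=Ev_Q(\mathcal{B}_D)$: $\mu_{s,0}(\mathcal{U}^A)=2\bigl(n(2n+g-1)-N_z(T_D)\bigr)$, $\mu_{s,0}(\mathcal{U}^R)=n(2n+g-1)-N_z(C\,T_{2D}^{-1})$, and $\mu_{s,0}(\mathcal{U}^{F,n}_{D,Q,\mathcal{P}})=\mu_{s,0}(\mathcal{U}^A)+\mu_{s,0}(\mathcal{U}^R)$. *)

theory Defs
  imports
    "HOL-Algebra.Algebraic_Closure_Type"
    "HOL-Algebra.Finite_Extensions"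
    "HOL-Algebra.Generated_Fields"
    "HOL-Algebra.QuotRing"
    "HOL-Number_Theory.Prime_Powers"
    "HOL-Library.Poly_Mapping"
    "Jordan_Normal_Form.Gauss_Jordan_Elimination"
begin

text \<open>
  The function field is the whole type \<open>'f\<close>; the constant field is a subset \<open>K\<close> of it.
  Places are represented by their maximal ideals, hence have type \<open>'f set\<close>. Linear algebra over
  \<open>K\<close>, both in the function field and in residue class fields, is that of
  \<^theory>\<open>HOL-Algebra.Embedded_Algebras\<close>, in which bases are lists.
\<close>

abbreviation FF :: "'f::field ring"
  where "FF \<equiv> ring_of_type_algebra"

definition is_basis :: "'a ring \<Rightarrow> 'a set \<Rightarrow> 'a list \<Rightarrow> 'a set \<Rightarrow> bool"
  where "is_basis R K Us E \<longleftrightarrow> ring.independent R K Us \<and> ring.Span R K Us = E"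


section \<open>Algebraic function fields of one variable\<close>

text \<open>
  \<open>K\<close> is not required to be algebraically closed in \<open>'f\<close>; this is automatic as soon as there is
  a place of degree one.
\<close>

definition function_field :: "'f::field set \<Rightarrow> bool"
  where "function_field K \<longleftrightarrow> subfield K FF \<and>
    (\<exists>x. ring.transcendental FF K x \<and>
         ring.finite_dimension FF (generate_field FF (insert x K)) UNIV)"

definition valuation_ring :: "'f::field set \<Rightarrow> 'f set \<Rightarrow> bool"
  where "valuation_ring K V \<longleftrightarrow>
    subring V FF \<and> K \<subset> V \<and> V \<subset> UNIV \<and> (\<forall>z. z \<in> V \<or> inverse z \<in> V)"

definition place :: "'f::field set \<Rightarrow> 'f set \<Rightarrow> bool"
  where "place K P \<longleftrightarrow> (\<exists>V. valuation_ring K V \<and> maximalideal P (FF\<lparr>carrier := V\<rparr>))"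

text \<open>
  The valuation ring belonging to \<open>P\<close> consists of those \<open>z\<close> with \<open>1/z \<notin> P\<close>; zero has to be
  added separately because \<open>inverse 0 = 0\<close>.
\<close>

definition place_ring :: "'f::field set \<Rightarrow> 'f ring"
  where "place_ring P = FF\<lparr>carrier := {z. z = 0 \<or> inverse z \<notin> P}\<rparr>"

text \<open>
  The discrete valuation: \<open>z = t\<^sup>m u\<close> with \<open>P = t\<O>\<close> and \<open>u\<close> a unit of the valuation ring \<open>\<O>\<close>.
  Meaningful for \<open>z \<noteq> 0\<close> only.
\<close>

definition place_val :: "'f::field set \<Rightarrow> 'f \<Rightarrow> int"
  where "place_val P z = (THE m. \<exists>t. P = (\<lambda>x. t * x) ` carrier (place_ring P) \<and>
    (\<exists>u \<in> Units (place_ring P). z = t powi m * u))"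

definition residue_field :: "'f::field set \<Rightarrow> 'f set ring"
  where "residue_field P = place_ring P Quot P"

definition residue :: "'f::field set \<Rightarrow> 'f \<Rightarrow> 'f set"
  where "residue P f = P +>\<^bsub>place_ring P\<^esub> f"

definition place_degree :: "'f::field set \<Rightarrow> 'f set \<Rightarrow> nat"
  where "place_degree K P =
    ring.dim (residue_field P) (residue P ` K) (carrier (residue_field P))"

text \<open>
  At a place of degree one the residue class field is identified with \<open>K\<close>, so the value of a
  function is the constant with the same residue class.
\<close>

definition value_at :: "'f::field set \<Rightarrow> 'f set \<Rightarrow> 'f \<Rightarrow> 'f"
  where "value_at K P f = (THE a. a \<in> K \<and> residue P a = residue P f)"


section \<open>Divisors and Riemann-Roch spaces\<close>

text \<open>
  Divisors form the free abelian group on the places. The place \<open>Q\<close> as a divisor is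
  \<open>Poly_Mapping.single Q 1\<close>, and \<open>keys D\<close> is the support of \<open>D\<close>.
\<close>

type_synonym 'f divisor = "'f set \<Rightarrow>\<^sub>0 int"

definition divisor :: "'f::field set \<Rightarrow> 'f divisor \<Rightarrow> bool"
  where "divisor K A \<longleftrightarrow> (\<forall>P \<in> Poly_Mapping.keys A. place K P)"

definition effective :: "'f::field divisor \<Rightarrow> bool"
  where "effective A \<longleftrightarrow> (\<forall>P. Poly_Mapping.lookup A P \<ge> 0)"

definition divisor_degree :: "'f::field set \<Rightarrow> 'f divisor \<Rightarrow> int"
  where "divisor_degree K A = (\<Sum>P \<in> Poly_Mapping.keys A. Poly_Mapping.lookup A P * int (place_degree K P))"

definition RR :: "'f::field set \<Rightarrow> 'f divisor \<Rightarrow> 'f set"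
  where "RR K A = {f. f = 0 \<or> (\<forall>P. place K P \<longrightarrow> place_val P f \<ge> - Poly_Mapping.lookup A P)}"

definition RR_dim :: "'f::field set \<Rightarrow> 'f divisor \<Rightarrow> nat"
  where "RR_dim K A = ring.dim FF K (RR K A)"

text \<open>That the maximum exists is Riemann's theorem.\<close>

definition genus :: "'f::field set \<Rightarrow> int"
  where "genus K = (GREATEST m. \<exists>A. divisor K A \<and> m = divisor_degree K A - int (RR_dim K A) + 1)"

definition index_of_speciality :: "'f::field set \<Rightarrow> 'f divisor \<Rightarrow> int"
  where "index_of_speciality K A = int (RR_dim K A) - divisor_degree K A + genus K - 1"

definition non_special :: "'f::field set \<Rightarrow> 'f divisor \<Rightarrow> bool"
  where "non_special K A \<longleftrightarrow> index_of_speciality K A = 0"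


section \<open>The Chudnovsky-Chudnovsky multiplication algorithm\<close>

definition Ev :: "'f::field set \<Rightarrow> 'f set list \<Rightarrow> 'f \<Rightarrow> 'f vec"
  where "Ev K Ps f = vec (length Ps) (\<lambda>i. value_at K (Ps ! i) f)"

text \<open>
  \<open>residue Q\<close> plays the role of \<open>E\<^sub>Q\<close>, and its restriction to \<open>\<L>(D)\<close> that of \<open>Ev\<^sub>Q\<close>. The list
  \<open>Ps\<close> is the ordered set of evaluation places, so \<open>N\<close> is its length.
\<close>

locale chudnovsky_algorithm =
  fixes K :: "'f::field set" and q n g :: nat
    and D :: "'f divisor" and Q :: "'f set" and Ps :: "'f set list"
  assumes prime_power: "primepow q"
    and card_K: "card K = q"
    and function_field: "function_field K"
    and genus: "genus K = int g"
    and n_pos: "n \<ge> 1"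
    and Q_place: "place K Q"
    and Q_degree: "place_degree K Q = n"
    and Ps_distinct: "distinct Ps"
    and Ps_places: "\<forall>P \<in> set Ps. place K P \<and> place_degree K P = 1"
    and D_divisor: "divisor K D"
    and D_support: "Poly_Mapping.keys D \<inter> insert Q (set Ps) = {}"
    and Ev_Q_surj: "residue Q ` RR K D = carrier (residue_field Q)"
    and Ev_Ps_inj: "inj_on (Ev K Ps) (RR K (D + D))"
    and D_effective: "effective D"
    and DQ_non_special: "non_special K (D - Poly_Mapping.single Q 1)"
    and DQ_degree: "divisor_degree K (D - Poly_Mapping.single Q 1) = int g - 1"
    and N_eq: "length Ps = RR_dim K (D + D)"

text \<open>\<open>BD\<close> is \<open>\<B>\<^sub>D\<close> and \<open>BDc\<close> is \<open>\<B>\<^sub>D\<^sup>c\<close>; the basis of \<open>\<L>(2D)\<close> is \<open>BD @ BDc\<close>.\<close>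

definition kernel_type ::
    "'f::field set \<Rightarrow> nat \<Rightarrow> 'f divisor \<Rightarrow> 'f set \<Rightarrow> 'f list \<Rightarrow> 'f list \<Rightarrow> bool"
  where "kernel_type K n D Q BD BDc \<longleftrightarrow>
    length BD = n \<and>
    is_basis FF K BD (RR K D) \<and>
    is_basis FF K BDc {f \<in> RR K (D + D). residue Q f = \<zero>\<^bsub>residue_field Q\<^esub>} \<and>
    is_basis FF K (BD @ BDc) (RR K (D + D))"


section \<open>Matrices and scalar complexity\<close>

definition mats :: "'f::field set \<Rightarrow> nat \<Rightarrow> 'f mat set"
  where "mats K n = {\<sigma> \<in> carrier_mat n n. elements_mat \<sigma> \<subseteq> K}"

definition GL :: "'f::field set \<Rightarrow> nat \<Rightarrow> 'f mat set"
  where "GL K n = {\<sigma> \<in> mats K n. \<exists>\<tau> \<in> mats K n. \<sigma> * \<tau> = 1\<^sub>m n \<and> \<tau> * \<sigma> = 1\<^sub>m n}"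

definition transform_basis :: "'f::field mat \<Rightarrow> 'f list \<Rightarrow> 'f list"
  where "transform_basis \<sigma> fs =
    map (\<lambda>j. \<Sum>i<length fs. \<sigma> $$ (i, j) * fs ! i) [0..<length fs]"

text \<open>
  Matrix of \<open>Ev K Ps\<close> with respect to the list \<open>fs\<close> and the canonical basis: applied to
  \<open>\<B>\<^sub>D\<close> this is \<open>T\<^sub>D\<close>, applied to \<open>\<B>\<^sub>2\<^sub>D\<close> it is \<open>T\<^sub>2\<^sub>D\<close>.
\<close>

definition eval_mat :: "'f::field set \<Rightarrow> 'f set list \<Rightarrow> 'f list \<Rightarrow> 'f mat"
  where "eval_mat K Ps fs = mat_of_cols (length Ps) (map (Ev K Ps) fs)"

text \<open>Coordinates in \<open>K\<close> of an element of the residue class field with respect to a basis \<open>BQ\<close>.\<close>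

definition coords :: "'f::field set \<Rightarrow> 'f set \<Rightarrow> 'f set list \<Rightarrow> 'f set \<Rightarrow> 'f list"
  where "coords K Q BQ x = (THE as. length as = length BQ \<and> set as \<subseteq> K \<and>
    ring.combine (residue_field Q) (map (residue Q) as) BQ = x)"

text \<open>The matrix \<open>C\<close> of \<open>E\<^sub>Q\<close> with respect to the bases \<open>fs\<close> and \<open>BQ\<close>.\<close>

definition residue_mat ::
    "'f::field set \<Rightarrow> 'f set \<Rightarrow> 'f set list \<Rightarrow> 'f list \<Rightarrow> 'f mat"
  where "residue_mat K Q BQ fs =
    mat_of_cols (length BQ) (map (\<lambda>f. vec_of_list (coords K Q BQ (residue Q f))) fs)"

definition mat_inv :: "'f::field mat \<Rightarrow> 'f mat"
  where "mat_inv A = the (mat_inverse A)"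

definition first_rows :: "nat \<Rightarrow> 'f mat \<Rightarrow> 'f mat"
  where "first_rows n A = mat n (dim_col A) (\<lambda>(i, j). A $$ (i, j))"

definition N_z :: "'f::zero mat \<Rightarrow> nat"
  where "N_z M = card {(i, j). i < dim_row M \<and> j < dim_col M \<and> M $$ (i, j) = 0}"

text \<open>
  The bilinear algorithm is determined by the bases \<open>BD @ BDc\<close> of \<open>\<L>(2D)\<close> and \<open>BQ\<close> of the
  residue class field, so its complexities are functions of these bases. They are integers
  to avoid truncated subtraction.
\<close>

definition mu_A :: "'f::field set \<Rightarrow> nat \<Rightarrow> nat \<Rightarrow> 'f set list \<Rightarrow> 'f list \<Rightarrow> int"
  where "mu_A K n g Ps BD =
    2 * (int n * (2 * int n + int g - 1) - int (N_z (eval_mat K Ps BD)))"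

definition mu_R :: "'f::field set \<Rightarrow> nat \<Rightarrow> nat \<Rightarrow> 'f set \<Rightarrow> 'f set list \<Rightarrow>
    'f list \<Rightarrow> 'f list \<Rightarrow> 'f set list \<Rightarrow> int"
  where "mu_R K n g Q Ps BD BDc BQ =
    int n * (2 * int n + int g - 1)
    - int (N_z (residue_mat K Q BQ (BD @ BDc) * mat_inv (eval_mat K Ps (BD @ BDc))))"

definition mu :: "'f::field set \<Rightarrow> nat \<Rightarrow> nat \<Rightarrow> 'f set \<Rightarrow> 'f set list \<Rightarrow>
    'f list \<Rightarrow> 'f list \<Rightarrow> 'f set list \<Rightarrow> int"
  where "mu K n g Q Ps BD BDc BQ = mu_A K n g Ps BD + mu_R K n g Q Ps BD BDc BQ"

text \<open>Complexity after replacing \<open>\<B>\<^sub>D\<close> by \<open>\<sigma>(\<B>\<^sub>D)\<close>, with \<open>\<B>\<^sub>Q = Ev\<^sub>Q(\<sigma>(\<B>\<^sub>D))\<close>.\<close>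

definition mu_transformed :: "'f::field set \<Rightarrow> nat \<Rightarrow> nat \<Rightarrow> 'f set \<Rightarrow> 'f set list \<Rightarrow>
    'f list \<Rightarrow> 'f list \<Rightarrow> 'f mat \<Rightarrow> int"
  where "mu_transformed K n g Q Ps BD BDc \<sigma> =
    mu K n g Q Ps (transform_basis \<sigma> BD) BDc (map (residue Q) (transform_basis \<sigma> BD))"

definition mu_opti :: "'f::field set \<Rightarrow> nat \<Rightarrow> nat \<Rightarrow> 'f set \<Rightarrow> 'f set list \<Rightarrow>
    'f list \<Rightarrow> 'f list \<Rightarrow> int"
  where "mu_opti K n g Q Ps BD BDc = Min (mu_transformed K n g Q Ps BD BDc ` GL K n)"

text \<open>The quantity \<open>2 N\<^sub>z(T\<^sub>\<sigma>\<^sub>(\<^sub>D\<^sub>)) + N\<^sub>z(T\<^sup>-\<^sup>1\<^sub>2\<^sub>\<sigma>\<^sub>(\<^sub>D\<^sub>)\<^sub>,\<^sub>n)\<close>.\<close>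

definition zero_count :: "'f::field set \<Rightarrow> nat \<Rightarrow> 'f set list \<Rightarrow> 'f list \<Rightarrow> 'f list \<Rightarrow> 'f mat \<Rightarrow> nat"
  where "zero_count K n Ps BD BDc \<sigma> =
    2 * N_z (eval_mat K Ps (transform_basis \<sigma> BD))
    + N_z (first_rows n (mat_inv (eval_mat K Ps (transform_basis \<sigma> BD @ BDc))))"

definition N_z_max :: "'f::field set \<Rightarrow> nat \<Rightarrow> 'f set list \<Rightarrow> 'f list \<Rightarrow> 'f list \<Rightarrow> nat"
  where "N_z_max K n Ps BD BDc = Max (zero_count K n Ps BD BDc ` GL K n)"

end

theory Submission
  imports Defs "Jordan_Normal_Form.Determinant"
begin

text \<open>
  With the basis \<open>\<sigma>(\<B>\<^sub>D) \<union> \<B>\<^sub>D\<^sup>c\<close> of \<open>\<L>(2D)\<close> and the basis \<open>Ev\<^sub>Q(\<sigma>(\<B>\<^sub>D))\<close> of the residue class field, the matrix \<open>C\<close> of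
  \<open>E\<^sub>Q\<close> is an identity block followed by a zero block: the first \<open>n\<close> basis functions are mapped to the
  basis, the others to zero (\<open>residue_mat_entry\<close>). Multiplying by \<open>C\<close> from the left therefore selects the
  first \<open>n\<close> rows, so that for every \<open>\<sigma>\<close> the complexity equals \<open>3n(2n + g - 1)\<close> minus the number of zeros
  \<open>2 N\<^sub>z(T\<^sub>\<sigma>\<^sub>(\<^sub>D\<^sub>)) + N\<^sub>z(T\<^sup>-\<^sup>1\<^sub>2\<^sub>\<sigma>\<^sub>(\<^sub>D\<^sub>)\<^sub>,\<^sub>n)\<close> (\<open>mu_transformed_eq\<close>). The general linear group over the finite field \<open>K\<close> is
  finite and nonempty, so both extrema exist, and minimising the complexity is maximising the number of
  zeros.

  The selection of rows is meaningful because \<open>T\<^sub>2\<^sub>\<sigma>\<^sub>(\<^sub>D\<^sub>)\<close> is invertible. It is a square matrix over \<open>K\<close> that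
  describes the map \<open>Ev\<close>, injective on \<open>\<L>(2D)\<close>; since \<open>K\<close> is finite, it permutes the vectors over
  \<open>K\<close> (\<open>mat_inv_eval_mat_carrier\<close>). This needs linearity of \<open>Ev\<close>, hence that the functions in \<open>\<L>(2D)\<close> are
  regular at the evaluation places, and that a regular function has a value in \<open>K\<close> at a place of degree
  one. The first rests on the valuation of a place being a discrete valuation, the second on its
  residue class field being finite-dimensional over the constants.

  Both facts come from one source. The function field is finite over some \<open>K(y)\<close> with \<open>y\<close> regular at the
  place, so sufficiently many functions satisfy a relation with coefficients in \<open>K[y]\<close>, not all of
  which vanish at the place (\<open>primitive_relation\<close>). Applied to a chain of proper divisors in the
  valuation ring, the relation bounds the length of the chain (\<open>no_long_chain\<close>), which gives a uniformizer and the
  factorization of every function into a power of it and a unit. Applied to representatives of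
  residue classes, it shows that there are only finitely many classes (\<open>finite_residues\<close>).
\<close>

section \<open>The function field as a ring\<close>

lemma FF_simps [simp]:
  "carrier (FF :: 'f::field ring) = UNIV"
  "x \<otimes>\<^bsub>FF\<^esub> y = x * (y :: 'f)"
  "x \<oplus>\<^bsub>FF\<^esub> y = x + (y :: 'f)"
  "\<one>\<^bsub>FF\<^esub> = (1 :: 'f)"
  "\<zero>\<^bsub>FF\<^esub> = (0 :: 'f)"
  by (simp_all add: ring_of_type_algebra_def)

lemma FF_field: "field (FF :: 'f::field ring)"
  by (rule field_from_type_algebra)

lemma FF_ring: "ring (FF :: 'f::field ring)"
  by (rule ring_from_type_algebra)

lemma FF_a_inv [simp]: "\<ominus>\<^bsub>FF\<^esub> x = - (x :: 'f::field)"
proof -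
  interpret R: ring "FF :: 'f ring" by (rule FF_ring)
  show ?thesis by (rule R.minus_equality) simp_all
qed

lemma FF_inv:
  assumes "x \<noteq> (0 :: 'f::field)"
  shows "inv\<^bsub>FF\<^esub> x = inverse x"
proof -
  interpret R: field "FF :: 'f ring" by (rule FF_field)
  show ?thesis using assms by (intro R.comm_inv_char) simp_all
qed

locale finite_constant_field =
  fixes K :: "'f::field set"
  assumes subfield: "subfield K FF" and finite_K: "finite K"
begin

lemma K_closed:
  "0 \<in> K" "1 \<in> K" "a \<in> K \<Longrightarrow> b \<in> K \<Longrightarrow> a + b \<in> K" "a \<in> K \<Longrightarrow> - a \<in> K"
  "a \<in> K \<Longrightarrow> b \<in> K \<Longrightarrow> a * b \<in> K"
  using subringE(2,3,7,5,6)[OF subfieldE(1)[OF subfield]] by simp_all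

lemma K_diff: "a \<in> K \<Longrightarrow> b \<in> K \<Longrightarrow> a - b \<in> K"
  using K_closed(3)[of a "- b"] K_closed(4) by simp

lemma K_inverse: "a \<in> K \<Longrightarrow> inverse a \<in> K"
proof (cases "a = 0")
  case False
  interpret R: ring "FF :: 'f ring" by (rule FF_ring)
  assume "a \<in> K"
  then show ?thesis using R.subfield_m_inv(1)[OF subfield, of a] False by (simp add: FF_inv)
qed (simp add: K_closed)

lemma K_sum: "(\<And>i. i \<in> I \<Longrightarrow> f i \<in> K) \<Longrightarrow> sum f I \<in> K"
  by (induction I rule: infinite_finite_induct) (auto simp: K_closed)

end

section \<open>Relations over the polynomials in a generator\<close>

definition polys_over :: "'f::field set \<Rightarrow> 'f Polynomial.poly set"
  where "polys_over K = {p. \<forall>i. Polynomial.coeff p i \<in> K}"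

definition poly_values :: "'f::field set \<Rightarrow> 'f \<Rightarrow> 'f set"
  where "poly_values K y = (\<lambda>p. Polynomial.poly p y) ` polys_over K"

context finite_constant_field
begin

lemma polys_over_closed:
  "0 \<in> polys_over K" "1 \<in> polys_over K"
  "p \<in> polys_over K \<Longrightarrow> r \<in> polys_over K \<Longrightarrow> p + r \<in> polys_over K"
  "p \<in> polys_over K \<Longrightarrow> r \<in> polys_over K \<Longrightarrow> p - r \<in> polys_over K"
  "p \<in> polys_over K \<Longrightarrow> - p \<in> polys_over K"
  "p \<in> polys_over K \<Longrightarrow> r \<in> polys_over K \<Longrightarrow> p * r \<in> polys_over K"
  "a \<in> K \<Longrightarrow> Polynomial.monom a k \<in> polys_over K"
  unfolding polys_over_def
  by (simp_all add: K_closed K_diff K_sum Polynomial.coeff_mult Polynomial.coeff_1)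

lemma poly_values_iff: "s \<in> poly_values K y \<longleftrightarrow> (\<exists>p\<in>polys_over K. s = Polynomial.poly p y)"
  unfolding poly_values_def by blast

lemma poly_valuesI: "p \<in> polys_over K \<Longrightarrow> s = Polynomial.poly p y \<Longrightarrow> s \<in> poly_values K y"
  unfolding poly_values_iff by blast

lemma poly_values_closed:
  "0 \<in> poly_values K y" "1 \<in> poly_values K y"
  "s \<in> poly_values K y \<Longrightarrow> t \<in> poly_values K y \<Longrightarrow> s + t \<in> poly_values K y"
  "s \<in> poly_values K y \<Longrightarrow> - s \<in> poly_values K y"
  "s \<in> poly_values K y \<Longrightarrow> t \<in> poly_values K y \<Longrightarrow> s * t \<in> poly_values K y"
proof -
  show "0 \<in> poly_values K y" by (rule poly_valuesI[OF polys_over_closed(1)]) simp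
  show "1 \<in> poly_values K y" by (rule poly_valuesI[OF polys_over_closed(2)]) simp
next
  assume "s \<in> poly_values K y" "t \<in> poly_values K y"
  then obtain p r where p: "p \<in> polys_over K" "s = Polynomial.poly p y"
    and r: "r \<in> polys_over K" "t = Polynomial.poly r y"
    unfolding poly_values_iff by blast
  show "s + t \<in> poly_values K y"
    by (rule poly_valuesI[OF polys_over_closed(3)[OF p(1) r(1)]]) (simp add: p r)
  show "s * t \<in> poly_values K y"
    by (rule poly_valuesI[OF polys_over_closed(6)[OF p(1) r(1)]]) (simp add: p r)
next
  assume "s \<in> poly_values K y"
  then obtain p where p: "p \<in> polys_over K" "s = Polynomial.poly p y"
    unfolding poly_values_iff by blast
  show "- s \<in> poly_values K y"
    by (rule poly_valuesI[OF polys_over_closed(5)[OF p(1)]]) (simp add: p)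
qed

lemma K_in_poly_values: "a \<in> K \<Longrightarrow> a \<in> poly_values K y"
  by (rule poly_valuesI[OF polys_over_closed(7)[of a 0]]) (simp_all add: Polynomial.poly_monom)

lemma generator_in_poly_values: "y \<in> poly_values K y"
  by (rule poly_valuesI[OF polys_over_closed(7)[OF K_closed(2), of 1]])
     (simp add: Polynomial.poly_monom)

lemma generate_field_fractions:
  assumes "x = y \<or> x = inverse y" and "c \<in> generate_field FF (insert x K)"
  shows "\<exists>a b. a \<in> poly_values K y \<and> b \<in> poly_values K y \<and> b \<noteq> 0 \<and> b * c = a"
  using assms(2)
proof (induction rule: generate_field.induct)
  case one
  then show ?case using poly_values_closed(2) by (intro exI[of _ 1]) auto
next
  case (incl h)
  then consider "h \<in> K" | "h = y" | "h = inverse y" "y \<noteq> 0"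
    using assms(1) by (cases "y = 0") auto
  then show ?case
  proof cases
    case 1
    then show ?thesis using K_in_poly_values poly_values_closed(2) by (intro exI[of _ h] exI[of _ 1]) auto
  next
    case 2
    then show ?thesis using generator_in_poly_values poly_values_closed(2)
      by (intro exI[of _ h] exI[of _ 1]) auto
  next
    case 3
    then show ?thesis using generator_in_poly_values poly_values_closed(2)
      by (intro exI[of _ 1] exI[of _ y]) auto
  qed
next
  case (a_inv h)
  then obtain a b where "a \<in> poly_values K y" "b \<in> poly_values K y" "b \<noteq> 0" "b * h = a" by auto
  then show ?case using poly_values_closed(4) by (intro exI[of _ "- a"] exI[of _ b]) auto
next
  case (m_inv h)
  then obtain a b where "a \<in> poly_values K y" "b \<in> poly_values K y" "b \<noteq> 0" "b * h = a" by auto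
  then show ?case using m_inv(2) by (intro exI[of _ b] exI[of _ a]) (auto simp: FF_inv)
next
  case (eng_add h k)
  then obtain a b a' b' where "a \<in> poly_values K y" "b \<in> poly_values K y" "b \<noteq> 0" "b * h = a"
    "a' \<in> poly_values K y" "b' \<in> poly_values K y" "b' \<noteq> 0" "b' * k = a'" by auto
  moreover have "(b * b') * (h + k) = (b * h) * b' + (b' * k) * b" by (simp add: algebra_simps)
  ultimately show ?case using poly_values_closed(3,5)
    by (intro exI[of _ "a * b' + a' * b"] exI[of _ "b * b'"]) simp
next
  case (eng_mult h k)
  then obtain a b a' b' where "a \<in> poly_values K y" "b \<in> poly_values K y" "b \<noteq> 0" "b * h = a"
    "a' \<in> poly_values K y" "b' \<in> poly_values K y" "b' \<noteq> 0" "b' * k = a'" by auto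
  moreover have "(b * b') * (h * k) = (b * h) * (b' * k)" by (simp add: mult_ac)
  ultimately show ?case using poly_values_closed(5)
    by (intro exI[of _ "a * a'"] exI[of _ "b * b'"]) simp
qed

lemma common_denominator:
  assumes "finite I" "x = y \<or> x = inverse y"
    and "\<And>i. i \<in> I \<Longrightarrow> c i \<in> generate_field FF (insert x K)"
  shows "\<exists>b. b \<in> poly_values K y \<and> b \<noteq> 0 \<and> (\<forall>i\<in>I. b * c i \<in> poly_values K y)"
  using assms(1,3)
proof (induction I rule: finite_induct)
  case empty
  then show ?case using poly_values_closed(2) by (intro exI[of _ 1]) auto
next
  case (insert j I)
  then obtain b where b: "b \<in> poly_values K y" "b \<noteq> 0" "\<forall>i\<in>I. b * c i \<in> poly_values K y" by auto
  obtain b' where b': "b' * c j \<in> poly_values K y" "b' \<in> poly_values K y" "b' \<noteq> 0"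
    using generate_field_fractions[OF assms(2), of "c j"] insert.prems by auto
  have "(b' * b) * c i \<in> poly_values K y" if "i \<in> insert j I" for i
  proof (cases "i = j")
    case True
    have "b * (b' * c j) \<in> poly_values K y" using b(1) b'(1) by (rule poly_values_closed(5))
    then show ?thesis using True by (simp add: mult_ac)
  next
    case False
    then have "b' * (b * c i) \<in> poly_values K y" using that b b' poly_values_closed(5) by auto
    then show ?thesis by (simp add: mult_ac)
  qed
  then show ?case using b b' poly_values_closed(5) by (intro exI[of _ "b' * b"]) auto
qed

end

lemma FF_combine:
  assumes "length Ks = length Us"
  shows "ring.combine FF Ks Us = (\<Sum>i<length Us. Ks ! i * (Us ! i :: 'f::field))"
proof -
  interpret R: ring "FF :: 'f ring" by (rule FF_ring)
  show ?thesis using assms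
  proof (induction Ks Us rule: list_induct2)
    case (Cons k Ks u Us)
    then show ?case by (simp add: sum.lessThan_Suc_shift del: sum.lessThan_Suc)
  qed simp
qed

text \<open>
  If \<open>d\<close> is the degree of the function field over \<open>K(x)\<close>, then any \<open>d + 1\<close> elements are dependent over
  \<open>K(x)\<close>, and clearing denominators brings the coefficients into \<open>K[y]\<close>. Since \<open>K(x) = K(1/x)\<close>, the generator
  \<open>y\<close> may be either of \<open>x\<close> and \<open>1/x\<close>; at every place one of the two is regular.
\<close>

lemma (in finite_constant_field) bounded_relations:
  assumes "function_field K"
  obtains x :: 'f and d :: nat where "\<And>y w. x = y \<or> x = inverse y \<Longrightarrow>
    \<exists>s. (\<forall>i\<le>d. s i \<in> poly_values K y) \<and> (\<exists>i\<le>d. s i \<noteq> 0) \<and> (\<Sum>i\<le>d. s i * w i) = 0"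
proof -
  interpret R: field "FF :: 'f ring" by (rule FF_field)
  from assms obtain x where x: "R.finite_dimension (generate_field FF (insert x K)) UNIV"
    unfolding function_field_def by auto
  define L where "L = generate_field FF (insert x K)"
  have L: "subfield L FF" unfolding L_def by (rule R.generate_field_is_subfield) auto
  obtain d where d: "R.dimension d L UNIV" using x unfolding L_def by auto
  show ?thesis
  proof (rule that[of x d])
    fix y :: 'f and w :: "nat \<Rightarrow> 'f" assume y: "x = y \<or> x = inverse y"
    let ?Us = "map w [0..<Suc d]"
    have "R.dependent L ?Us"
      using R.independent_length_le_dimension[OF L d, of ?Us] by (auto simp del: upt_Suc)
    then obtain Ks where Ks: "length Ks = length ?Us" "R.combine Ks ?Us = 0" "set Ks \<subseteq> L" "set Ks \<noteq> {0}"
      using R.dependent_imp_non_trivial_combine[OF L, of ?Us] by (auto simp del: upt_Suc)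
    have len: "length Ks = Suc d" using Ks(1) by simp
    have sum0: "(\<Sum>i\<le>d. Ks ! i * w i) = 0"
    proof -
      have "(\<Sum>i\<le>d. Ks ! i * w i) = (\<Sum>i<length ?Us. Ks ! i * ?Us ! i)"
        by (intro sum.cong) (auto simp del: upt_Suc)
      then show ?thesis using Ks(2) FF_combine[OF Ks(1)] by simp
    qed
    have "\<exists>b. b \<in> poly_values K y \<and> b \<noteq> 0 \<and> (\<forall>i\<in>{..d}. b * Ks ! i \<in> poly_values K y)"
    proof (rule common_denominator[OF _ y])
      fix i assume "i \<in> {..d}"
      then have "Ks ! i \<in> set Ks" using len by simp
      then show "Ks ! i \<in> generate_field FF (insert x K)" using Ks(3) by (auto simp: L_def)
    qed simp
    then obtain b where b: "b \<in> poly_values K y" "b \<noteq> 0" "\<And>i. i \<le> d \<Longrightarrow> b * Ks ! i \<in> poly_values K y"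
      by auto
    have "set Ks \<noteq> {}" using len by auto
    then have "\<not> set Ks \<subseteq> {0}" using Ks(4) by (metis subset_singletonD)
    then obtain k where "k \<in> set Ks" "k \<noteq> 0" by blast
    then obtain i where "i \<le> d" "Ks ! i \<noteq> 0" using len by (metis in_set_conv_nth less_Suc_eq_le)
    moreover have "(\<Sum>i\<le>d. (b * Ks ! i) * w i) = 0"
      using sum0 by (simp add: mult.assoc flip: sum_distrib_left)
    ultimately show "\<exists>s. (\<forall>i\<le>d. s i \<in> poly_values K y) \<and> (\<exists>i\<le>d. s i \<noteq> 0) \<and> (\<Sum>i\<le>d. s i * w i) = 0"
      using b by (intro exI[of _ "\<lambda>i. b * Ks ! i"]) auto
  qed
qed

section \<open>The valuation ring of a place\<close>

text \<open>
  A place is represented by its maximal ideal \<open>P\<close> alone; \<open>V\<close> is the valuation ring recovered from it.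
\<close>

locale function_field_place = finite_constant_field K for K :: "'f::field set" +
  fixes P :: "'f set"
  assumes function_field: "function_field K" and place: "place K P"
begin

definition V :: "'f set"
  where "V = carrier (place_ring P)"

lemma place_ring_eq: "place_ring P = FF\<lparr>carrier := V\<rparr>"
  unfolding V_def place_ring_def by simp

lemma V_iff: "z \<in> V \<longleftrightarrow> z = 0 \<or> inverse z \<notin> P"
  unfolding V_def place_ring_def by simp

text \<open>
  The non-units of the valuation ring \<open>W\<close> that witnesses the place form an ideal: of two of them one is a
  multiple of the other, so their sum is a multiple of a non-unit. As this ideal contains the
  maximal ideal \<open>P\<close>, the two agree. So \<open>P\<close> determines \<open>W\<close>, which turns out to be \<open>V\<close>.
\<close>

lemma valuation_ring_properties:
  shows V_subring: "subring V FF" and K_subset_V: "K \<subseteq> V" and V_not_UNIV: "V \<noteq> UNIV"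
    and V_total: "z \<in> V \<or> inverse z \<in> V"
    and P_iff: "z \<in> P \<longleftrightarrow> z \<in> V \<and> (z = 0 \<or> inverse z \<notin> V)"
    and P_maximal: "maximalideal P (FF\<lparr>carrier := V\<rparr>)"
proof -
  interpret R: ring "FF :: 'f ring" by (rule FF_ring)
  obtain W where W: "valuation_ring K W" "maximalideal P (FF\<lparr>carrier := W\<rparr>)"
    using place unfolding place_def by blast
  then have sub: "subring W FF" and KW: "K \<subset> W" "W \<subset> UNIV" and total: "\<And>z. z \<in> W \<or> inverse z \<in> W"
    unfolding valuation_ring_def by auto
  note cl = subringE(2,3,7,5,6)[OF sub, simplified]
  interpret I: maximalideal P "FF\<lparr>carrier := W\<rparr>" by (rule W(2))
  have PW: "P \<subseteq> W" using I.a_subset by simp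
  define M where "M = {z \<in> W. z = 0 \<or> inverse z \<notin> W}"
  have mult: "a * r \<in> M" if "a \<in> M" "r \<in> W" for a r
  proof -
    have "a \<in> W" using that unfolding M_def by simp
    show ?thesis
    proof (cases "a * r = 0")
      case False
      have "inverse (a * r) \<notin> W"
      proof
        assume "inverse (a * r) \<in> W"
        then have "r * inverse (a * r) \<in> W" using that cl(5) by blast
        moreover have "r * inverse (a * r) = inverse a" using False by (simp add: field_simps)
        ultimately have "inverse a \<in> W" by metis
        then show False using that False unfolding M_def by auto
      qed
      then show ?thesis using cl(5)[OF \<open>a \<in> W\<close> that(2)] unfolding M_def by simp
    next
      case True
      then have "a * r = 0" by simp
      then show ?thesis using cl(1) by (metis (mono_tags, lifting) M_def mem_Collect_eq)
    qed
  qed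
  have add: "a + b \<in> M" if "a \<in> M" "b \<in> M" for a b
  proof (cases "a = 0 \<or> b = 0")
    case False
    have sum: "u + v \<in> M" if "u \<in> M" "v \<in> M" "v \<noteq> 0" "u / v \<in> W" for u v
    proof -
      have "v * (1 + u / v) \<in> M" using that cl by (intro mult) auto
      moreover have "v * (1 + u / v) = u + v" using that by (simp add: field_simps)
      ultimately show ?thesis by simp
    qed
    have "a / b \<in> W \<or> b / a \<in> W" using total[of "a / b"] by simp
    then show ?thesis using sum[of a b] sum[of b a] that False by (auto simp: add.commute)
  qed (use that in auto)
  have neg: "- a \<in> M" if "a \<in> M" for a
    using mult[OF that cl(4)[OF cl(2)]] by simp
  have "ideal M (FF\<lparr>carrier := W\<rparr>)"
  proof (rule idealI)
    show "ring (FF\<lparr>carrier := W\<rparr>)" by (rule R.subring_is_ring[OF sub])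
    have inv: "\<ominus>\<^bsub>FF\<lparr>carrier := W\<rparr>\<^esub> a = - a" if "a \<in> W" for a
      using that cl by (intro I.minus_equality) auto
    have "M \<subseteq> W" unfolding M_def by auto
    show "subgroup M (add_monoid (FF\<lparr>carrier := W\<rparr>))"
    proof (rule I.add.subgroupI)
      show "M \<subseteq> carrier (FF\<lparr>carrier := W\<rparr>)" using \<open>M \<subseteq> W\<close> by simp
      have "0 \<in> M" unfolding M_def using cl by simp
      then show "M \<noteq> {}" by auto
      show "\<ominus>\<^bsub>FF\<lparr>carrier := W\<rparr>\<^esub> a \<in> M" if "a \<in> M" for a
        using that inv[of a] neg \<open>M \<subseteq> W\<close> by auto
      show "a \<oplus>\<^bsub>FF\<lparr>carrier := W\<rparr>\<^esub> b \<in> M" if "a \<in> M" "b \<in> M" for a b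
        using that add by simp
    qed
    show "x \<otimes>\<^bsub>FF\<lparr>carrier := W\<rparr>\<^esub> a \<in> M" if "a \<in> M" "x \<in> carrier (FF\<lparr>carrier := W\<rparr>)" for a x
      using that mult[of a x] by (simp add: mult.commute)
    show "a \<otimes>\<^bsub>FF\<lparr>carrier := W\<rparr>\<^esub> x \<in> M" if "a \<in> M" "x \<in> carrier (FF\<lparr>carrier := W\<rparr>)" for a x
      using that mult[of a x] by simp
  qed
  moreover have "P \<subseteq> M"
  proof
    fix z assume z: "z \<in> P"
    have "inverse z \<notin> W" if "z \<noteq> 0"
    proof
      assume "inverse z \<in> W"
      then have "z * inverse z \<in> P" using I.I_r_closed[OF z, of "inverse z"] by simp
      then have "1 \<in> P" using that by simp
      then have "W \<subseteq> P" using I.I_l_closed[of 1] by auto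
      then show False using I.I_notcarr PW by auto
    qed
    then show "z \<in> M" unfolding M_def using z PW by auto
  qed
  moreover have "M \<subseteq> W" "1 \<notin> M" unfolding M_def using cl by auto
  ultimately have "M = P" using I.I_maximal[of M] cl(2) by auto
  have "V = W"
  proof -
    have "z \<in> V \<longleftrightarrow> z \<in> W" for z
      using total[of z] \<open>M = P\<close> cl(1) unfolding V_iff M_def
      by (cases "z = 0") (auto)
    then show ?thesis by blast
  qed
  then show "subring V FF" "K \<subseteq> V" "V \<noteq> UNIV" "z \<in> V \<or> inverse z \<in> V"
    "z \<in> P \<longleftrightarrow> z \<in> V \<and> (z = 0 \<or> inverse z \<notin> V)" "maximalideal P (FF\<lparr>carrier := V\<rparr>)"
    using sub KW total \<open>M = P\<close> W(2) unfolding M_def by auto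
qed

lemma V_closed:
  "0 \<in> V" "1 \<in> V" "a \<in> V \<Longrightarrow> b \<in> V \<Longrightarrow> a + b \<in> V" "a \<in> V \<Longrightarrow> - a \<in> V"
  "a \<in> V \<Longrightarrow> b \<in> V \<Longrightarrow> a * b \<in> V"
  using subringE(2,3,7,5,6)[OF V_subring] by simp_all

lemma V_power: "a \<in> V \<Longrightarrow> a ^ k \<in> V"
  by (induction k) (auto simp: V_closed)

lemma V_sum: "(\<And>i. i \<in> I \<Longrightarrow> f i \<in> V) \<Longrightarrow> sum f I \<in> V"
  by (induction I rule: infinite_finite_induct) (auto simp: V_closed)

lemma P_closed:
  "0 \<in> P" "1 \<notin> P" "a \<in> P \<Longrightarrow> b \<in> P \<Longrightarrow> a + b \<in> P" "a \<in> P \<Longrightarrow> - a \<in> P"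
  "a \<in> P \<Longrightarrow> b \<in> V \<Longrightarrow> a * b \<in> P" "a \<in> V \<Longrightarrow> b \<in> P \<Longrightarrow> a * b \<in> P"
proof -
  interpret I: maximalideal P "FF\<lparr>carrier := V\<rparr>" by (rule P_maximal)
  show "0 \<in> P" "1 \<notin> P" using P_iff V_closed by auto
  show "a \<in> P \<Longrightarrow> b \<in> P \<Longrightarrow> a + b \<in> P" 
    using subgroup.m_closed[OF I.a_subgroup, of a b] by simp
  show *: "a \<in> P \<Longrightarrow> b \<in> V \<Longrightarrow> a * b \<in> P" for a b using I.I_r_closed[of a b] by simp
  show "a \<in> V \<Longrightarrow> b \<in> P \<Longrightarrow> a * b \<in> P" using *[of b a] by (simp add: mult.commute)
  show "a \<in> P \<Longrightarrow> - a \<in> P" using *[of a "- 1"] V_closed(2,4) by simp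
qed

lemma P_diff: "a \<in> P \<Longrightarrow> b \<in> P \<Longrightarrow> a - b \<in> P"
  using P_closed(3)[of a "- b"] P_closed(4) by simp

lemma P_sum: "(\<And>i. i \<in> I \<Longrightarrow> f i \<in> P) \<Longrightarrow> sum f I \<in> P"
  by (induction I rule: infinite_finite_induct) (auto simp: P_closed)

lemma P_subset_V: "a \<in> P \<Longrightarrow> a \<in> V"
  using P_iff by blast

lemma unit_inverse: "a \<in> V \<Longrightarrow> a \<notin> P \<Longrightarrow> a \<noteq> 0 \<and> inverse a \<in> V \<and> inverse a \<notin> P"
  using P_iff[of a] P_iff[of "inverse a"] by auto

lemma quotient_in_P: "a / b \<notin> V \<Longrightarrow> b / a \<in> P"
  using V_total[of "a / b"] V_closed(1) P_iff[of "b / a"] by (auto simp: divide_simps)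

lemma P_prime:
  assumes "a \<in> V" "b \<in> V" "a * b \<in> P"
  shows "a \<in> P \<or> b \<in> P"
proof (rule disjCI)
  assume "b \<notin> P"
  then have "b \<noteq> 0" "inverse b \<in> V" using unit_inverse assms(2) by auto
  then have "(a * b) * inverse b \<in> P" using P_closed(5)[OF assms(3)] by blast
  then show "a \<in> P" using \<open>b \<noteq> 0\<close> by (simp add: mult.assoc)
qed

lemma K_inter_P: "a \<in> K \<Longrightarrow> a \<in> P \<Longrightarrow> a = 0"
  using K_inverse[of a] K_subset_V P_iff[of a] by auto

lemma V_integrally_closed:
  assumes "a ^ m \<in> V" "m > 0" shows "a \<in> V"
proof (rule ccontr)
  assume a: "a \<notin> V"
  then have "inverse a \<in> V" "a \<noteq> 0" using V_total V_closed(1) by auto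
  then have "a ^ m * inverse a ^ (m - 1) \<in> V" using assms V_closed(5) V_power by auto
  moreover have "a ^ m * inverse a ^ (m - 1) = a"
    using \<open>a \<noteq> 0\<close> assms(2) by (cases m) (auto simp: power_inverse field_simps)
  ultimately show False using a by simp
qed

end

section \<open>Finiteness of ramification and of the residue class field\<close>

text \<open>
  The finiteness of the function field over \<open>K(y)\<close> enters the study of a place only through this
  bound \<open>d\<close> on the length of families without a relation over \<open>K[y]\<close>, for a \<open>y\<close> regular at the place.
\<close>

locale function_field_place_bounded = function_field_place K P for K P :: "'f::field set" +
  fixes y :: 'f and d :: nat
  assumes y_V: "y \<in> V"
    and relation: "\<exists>s. (\<forall>i\<le>d. s i \<in> poly_values K y) \<and> (\<exists>i\<le>d. s i \<noteq> 0) \<and> (\<Sum>i\<le>d. s i * w i) = 0"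
begin

abbreviation "S \<equiv> poly_values K y"

lemma S_subset_V: "s \<in> S \<Longrightarrow> s \<in> V"
  unfolding poly_values_iff polys_over_def Polynomial.poly_altdef
  using K_subset_V y_V by (auto intro!: V_sum V_closed(5) V_power)

text \<open>
  In a relation among \<open>1, z, \<dots>, z\<^sup>d\<close>, divided by the lowest power of \<open>z\<close> that occurs, the constant term is
  an element of \<open>K[y]\<close> and a multiple of \<open>z\<close>. For \<open>z \<in> P\<close> this shows that \<open>P\<close> meets \<open>K[y]\<close> nontrivially.
\<close>

lemma multiple_in_S:
  assumes "z \<in> V" "z \<noteq> 0"
  shows "\<exists>s\<in>S. s \<noteq> 0 \<and> s / z \<in> V"
proof -
  obtain s where s: "\<forall>i\<le>d. s i \<in> S" "\<exists>i\<le>d. s i \<noteq> 0" "(\<Sum>i\<le>d. s i * z ^ i) = 0"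
    using relation[of "\<lambda>i. z ^ i"] by blast
  define k where "k = (LEAST i. i \<le> d \<and> s i \<noteq> 0)"
  have k: "k \<le> d" "s k \<noteq> 0" using LeastI_ex[OF s(2)] unfolding k_def by auto
  have less: "s i = 0" if "i < k" for i
    using not_less_Least[of i "\<lambda>i. i \<le> d \<and> s i \<noteq> 0"] that k(1) unfolding k_def by auto
  define r where "r = (\<Sum>i\<in>{k<..d}. s i * z ^ (i - k - 1))"
  have "0 = (\<Sum>i\<in>{k..d}. s i * z ^ i)"
    using s(3) less by (subst sum.mono_neutral_left[of "{..d}"]) auto
  also have "{k..d} = insert k {k<..d}" using k(1) by auto
  also have "(\<Sum>i\<in>insert k {k<..d}. s i * z ^ i) = s k * z ^ k + (\<Sum>i\<in>{k<..d}. s i * z ^ i)"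
    by simp
  also have "(\<Sum>i\<in>{k<..d}. s i * z ^ i) = z ^ k * (z * r)"
    unfolding r_def sum_distrib_left
  proof (rule sum.cong)
    fix i assume "i \<in> {k<..d}"
    then have "z ^ i = z ^ k * (z * z ^ (i - k - 1))"
      by (simp flip: power_Suc power_add)
    then show "s i * z ^ i = z ^ k * (z * (s i * z ^ (i - k - 1)))" by simp
  qed simp
  finally have "z ^ k * (s k + z * r) = 0" by (simp add: algebra_simps)
  then have "s k = z * (- r)" using assms(2) by (simp add: eq_neg_iff_add_eq_0)
  moreover have "r \<in> V" unfolding r_def
    using s(1) S_subset_V assms(1) by (intro V_sum V_closed(5) V_power) auto
  ultimately have "s k / z \<in> V" using V_closed(4) assms(2) by simp
  then show ?thesis using s(1) k by auto
qed

end

text \<open>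
  Division with remainder inside \<open>K[X]\<close>, seen as a part of the polynomials over the whole function field. The degree
  bound on the quotient makes the inductions on the degree below terminate.
\<close>

lemma (in finite_constant_field) polys_over_division:
  assumes p: "p \<in> polys_over K" "Polynomial.degree p > 0" and q: "q \<in> polys_over K"
  shows "\<exists>g r. g \<in> polys_over K \<and> r \<in> polys_over K \<and> q = p * g + r \<and>
    Polynomial.degree r < Polynomial.degree p \<and> (g = 0 \<or> Polynomial.degree g < Polynomial.degree q)"
  using q
proof (induction "Polynomial.degree q" arbitrary: q rule: less_induct)
  case less
  let ?deg = "Polynomial.degree :: 'f Polynomial.poly \<Rightarrow> nat"
  show ?case
  proof (cases "?deg q < ?deg p")
    case True
    then show ?thesis using less.prems polys_over_closed(1) by (intro exI[of _ 0] exI[of _ q]) auto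
  next
    case False
    define k where "k = ?deg q - ?deg p"
    define c where "c = Polynomial.lead_coeff q / Polynomial.lead_coeff p"
    define m where "m = Polynomial.monom c k"
    have p0: "p \<noteq> 0" using p(2) by auto
    have c: "c \<in> K" using p(1) less.prems K_closed(5) K_inverse
      unfolding c_def polys_over_def divide_inverse by auto
    have m: "m \<in> polys_over K" using polys_over_closed(7)[OF c] unfolding m_def .
    define q' where "q' = q - p * m"
    have q': "q' \<in> polys_over K" unfolding q'_def
      using less.prems p(1) m by (intro polys_over_closed)
    have deg_pm: "?deg (p * m) \<le> ?deg q"
      using Polynomial.degree_mult_le[of p m] Polynomial.degree_monom_le[of c k] False
      unfolding m_def k_def by linarith
    have "Polynomial.coeff (p * m) (?deg q) = Polynomial.lead_coeff q"
    proof -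
      have "Polynomial.coeff (p * m) (k + ?deg p) = c * Polynomial.coeff p (?deg p)"
        unfolding m_def by (subst mult.commute) (simp add: Polynomial.coeff_monom_mult)
      moreover have "k + ?deg p = ?deg q" using False unfolding k_def by simp
      ultimately show ?thesis using p0 unfolding c_def by simp
    qed
    then have "Polynomial.coeff q' (?deg q) = 0" unfolding q'_def by simp
    moreover have "?deg q' \<le> ?deg q" unfolding q'_def using deg_pm by (intro Polynomial.degree_diff_le) auto
    ultimately have deg_q': "?deg q' < ?deg q"
      using False p(2) by (metis Polynomial.leading_coeff_0_iff le_neq_implies_less neq0_conv
          Polynomial.degree_0 not_less_iff_gr_or_eq less_le_trans)
    obtain g r where gr: "g \<in> polys_over K" "r \<in> polys_over K" "q' = p * g + r"
      "?deg r < ?deg p" "g = 0 \<or> ?deg g < ?deg q'"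
      using less.hyps[OF deg_q' q'] by blast
    have "?deg m < ?deg q" using Polynomial.degree_monom_le[of c k] False p(2) unfolding m_def k_def by linarith
    then have "?deg (g + m) < ?deg q" using gr(5) deg_q'
      by (auto intro: Polynomial.degree_add_less)
    moreover have "q = p * (g + m) + r" using gr(3) unfolding q'_def by (simp add: algebra_simps)
    ultimately show ?thesis using gr m polys_over_closed(3) by blast
  qed
qed

lemma (in finite_constant_field) finite_polys_over:
  "finite {r \<in> polys_over K. Polynomial.degree r < e}"
proof -
  have "{r \<in> polys_over K. Polynomial.degree r < e} \<subseteq> Poly ` {xs. set xs \<subseteq> K \<and> length xs = e}"
  proof
    fix r assume r: "r \<in> {r \<in> polys_over K. Polynomial.degree r < e}"
    let ?xs = "map (Polynomial.coeff r) [0..<e]"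
    have "r = Poly ?xs"
    proof (rule Polynomial.poly_eqI)
      fix i
      show "Polynomial.coeff r i = Polynomial.coeff (Poly ?xs) i"
        using r Polynomial.coeff_eq_0[of r i] unfolding Polynomial.coeff_Poly_eq nth_default_def
        by (cases "i < e") simp_all
    qed
    moreover have "?xs \<in> {xs. set xs \<subseteq> K \<and> length xs = e}"
      using r unfolding polys_over_def by auto
    ultimately show "r \<in> Poly ` {xs. set xs \<subseteq> K \<and> length xs = e}" by (rule image_eqI)
  qed
  then show ?thesis by (rule finite_subset[OF _ finite_imageI[OF finite_lists_length_eq[OF finite_K]]])
qed

context function_field_place_bounded
begin

text \<open>
  The place of \<open>K(y)\<close> below \<open>P\<close>: \<open>x\<close> is the value of a polynomial \<open>p\<close> of least degree that takes a nonzero value in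
  \<open>P\<close>. Division by \<open>p\<close> shows that \<open>x\<close> generates the ideal \<open>S \<inter> P\<close>, and that the remainders, finitely many
  since \<open>K\<close> is finite, represent all of \<open>S\<close> modulo \<open>P\<close>; the set \<open>A\<close> consists of them.
\<close>

lemma local_parameter_of_S:
  obtains x A where "x \<in> S" "x \<in> P" "x \<noteq> 0"
    "\<And>s. s \<in> S \<Longrightarrow> s \<in> P \<Longrightarrow> \<exists>s'\<in>S. s = x * s'"
    "\<And>s. s \<in> S \<Longrightarrow> s \<noteq> 0 \<Longrightarrow> \<exists>m. \<exists>s'\<in>S. s' \<notin> P \<and> s = x ^ m * s'"
    "finite A" "A \<subseteq> S" "\<And>s. s \<in> S \<Longrightarrow> \<exists>a\<in>A. s - a \<in> P"
proof -
  let ?deg = "Polynomial.degree :: 'f Polynomial.poly \<Rightarrow> nat"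
  define good where "good p \<longleftrightarrow> p \<in> polys_over K \<and> Polynomial.poly p y \<in> P \<and> Polynomial.poly p y \<noteq> 0" for p
  obtain z where z: "z \<notin> V" using V_not_UNIV by blast
  then have "inverse z \<in> P" "inverse z \<noteq> 0" using P_iff[of "inverse z"] V_total[of z] V_closed(1) by auto
  then obtain s where s: "s \<in> S" "s \<noteq> 0" "s / inverse z \<in> V"
    using multiple_in_S[of "inverse z"] P_subset_V by blast
  have "inverse z * (s / inverse z) \<in> P" using P_closed(5)[OF \<open>inverse z \<in> P\<close> s(3)] .
  then have "s \<in> P" using \<open>inverse z \<noteq> 0\<close> by (simp add: field_simps)
  then have "\<exists>p. good p" using s(1,2) unfolding good_def poly_values_iff by blast
  then obtain p where p: "good p" "\<And>r. good r \<Longrightarrow> ?deg p \<le> ?deg r"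
    using ex_has_least_nat[of good _ ?deg] by blast
  have pK: "p \<in> polys_over K" using p(1) unfolding good_def by simp
  define x where "x = Polynomial.poly p y"
  have x: "x \<in> S" "x \<in> P" "x \<noteq> 0" using p(1) poly_valuesI unfolding good_def x_def by auto
  have deg_p: "?deg p > 0"
  proof (rule ccontr)
    assume "\<not> ?thesis"
    then obtain c where c: "p = [:c:]" using Polynomial.degree_eq_zeroE[of p] by blast
    have "Polynomial.coeff p 0 \<in> K" using pK unfolding polys_over_def by blast
    then show False using K_inter_P[of c] x unfolding x_def c by simp
  qed
  have divide: "\<exists>g r. g \<in> polys_over K \<and> r \<in> polys_over K \<and> ?deg r < ?deg p \<and>
      Polynomial.poly q y = x * Polynomial.poly g y + Polynomial.poly r y \<and>
      (g = 0 \<or> ?deg g < ?deg q)" if qK: "q \<in> polys_over K" for q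
  proof -
    obtain g r where "g \<in> polys_over K" "r \<in> polys_over K" "q = p * g + r" "?deg r < ?deg p"
      "g = 0 \<or> ?deg g < ?deg q" using polys_over_division[OF pK deg_p qK] by blast
    moreover from this have "Polynomial.poly q y = x * Polynomial.poly g y + Polynomial.poly r y"
      unfolding x_def by simp
    ultimately show ?thesis by blast
  qed
  have reduce: "\<exists>g\<in>polys_over K. Polynomial.poly q y = x * Polynomial.poly g y \<and> (g = 0 \<or> ?deg g < ?deg q)"
    if q: "q \<in> polys_over K" "Polynomial.poly q y \<in> P" for q
  proof -
    obtain g r where gr: "g \<in> polys_over K" "r \<in> polys_over K" "?deg r < ?deg p"
      "Polynomial.poly q y = x * Polynomial.poly g y + Polynomial.poly r y" "g = 0 \<or> ?deg g < ?deg q"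
      using divide[OF q(1)] by blast
    have "x * Polynomial.poly g y \<in> P"
      using x(2) S_subset_V[OF poly_valuesI[OF gr(1) refl]] by (rule P_closed(5))
    then have "Polynomial.poly r y \<in> P" using P_diff[OF q(2)] gr(4) by fastforce
    then have "Polynomial.poly r y = 0" using p(2)[of r] gr(2,3) unfolding good_def by fastforce
    then show ?thesis using gr by auto
  qed
  show thesis
  proof (rule that[of x "(\<lambda>r. Polynomial.poly r y) ` {r \<in> polys_over K. ?deg r < ?deg p}"])
    show "x \<in> S" "x \<in> P" "x \<noteq> 0" by (rule x)+
    show "\<exists>s'\<in>S. s = x * s'" if sS: "s \<in> S" "s \<in> P" for s
    proof -
      obtain q where q: "q \<in> polys_over K" "s = Polynomial.poly q y" using sS poly_values_iff by blast
      then show ?thesis using reduce[OF q(1)] sS(2) poly_valuesI[OF _ refl] by blast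
    qed
    show "\<exists>m. \<exists>s'\<in>S. s' \<notin> P \<and> s = x ^ m * s'" if "s \<in> S" "s \<noteq> 0" for s
    proof -
      have "\<exists>m. \<exists>s'\<in>S. s' \<notin> P \<and> Polynomial.poly q y = x ^ m * s'"
        if "q \<in> polys_over K" "Polynomial.poly q y \<noteq> 0" for q
        using that
      proof (induction "?deg q" arbitrary: q rule: less_induct)
        case less
        show ?case
        proof (cases "Polynomial.poly q y \<in> P")
          case True
          then obtain g where g: "g \<in> polys_over K" "Polynomial.poly q y = x * Polynomial.poly g y"
            "g = 0 \<or> ?deg g < ?deg q" using reduce less.prems by blast
          then have "Polynomial.poly g y \<noteq> 0" using less.prems by auto
          then obtain m s' where "s' \<in> S" "s' \<notin> P" "Polynomial.poly g y = x ^ m * s'"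
            using less.hyps[of g] g by auto
          then show ?thesis using g by (intro exI[of _ "Suc m"] bexI[of _ s']) auto
        next
          case False
          then show ?thesis using poly_valuesI[OF less.prems(1) refl]
            by (intro exI[of _ 0] bexI[of _ "Polynomial.poly q y"]) auto
        qed
      qed
      then show ?thesis using that unfolding poly_values_iff by blast
    qed
    show "finite ((\<lambda>r. Polynomial.poly r y) ` {r \<in> polys_over K. ?deg r < ?deg p})"
      using finite_polys_over by blast
    show "(\<lambda>r. Polynomial.poly r y) ` {r \<in> polys_over K. ?deg r < ?deg p} \<subseteq> S"
      using poly_valuesI[OF _ refl] by blast
    show "\<exists>a\<in>(\<lambda>r. Polynomial.poly r y) ` {r \<in> polys_over K. ?deg r < ?deg p}. s - a \<in> P" if sS: "s \<in> S" for s
    proof -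
      obtain q where q: "q \<in> polys_over K" "s = Polynomial.poly q y" using sS poly_values_iff by blast
      obtain g r where gr: "g \<in> polys_over K" "r \<in> polys_over K" "?deg r < ?deg p"
        "Polynomial.poly q y = x * Polynomial.poly g y + Polynomial.poly r y"
        using divide[OF q(1)] by blast
      have "x * Polynomial.poly g y \<in> P"
        using x(2) S_subset_V[OF poly_valuesI[OF gr(1) refl]] by (rule P_closed(5))
      then show ?thesis using gr q(2) by (intro bexI[of _ "Polynomial.poly r y"]) auto
    qed
  qed
qed

text \<open>
  Cancel the largest power of \<open>x\<close> that divides all coefficients of a relation.
\<close>

lemma primitive_relation:
  shows "\<exists>s. (\<forall>i\<le>d. s i \<in> S) \<and> (\<exists>i\<le>d. s i \<notin> P) \<and> (\<Sum>i\<le>d. s i * w i) = 0"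
proof -
  obtain x where x: "x \<in> S" "x \<noteq> 0"
    "\<And>s. s \<in> S \<Longrightarrow> s \<noteq> 0 \<Longrightarrow> \<exists>m. \<exists>s'\<in>S. s' \<notin> P \<and> s = x ^ m * s'"
    by (rule local_parameter_of_S) (rule that; blast)
  obtain s where s: "\<forall>i\<le>d. s i \<in> S" "\<exists>i\<le>d. s i \<noteq> 0" "(\<Sum>i\<le>d. s i * w i) = 0"
    using relation[of w] by blast
  define I where "I = {i. i \<le> d \<and> s i \<noteq> 0}"
  have I: "finite I" "I \<noteq> {}" using s(2) unfolding I_def by auto
  have "\<forall>i\<in>I. \<exists>m u. u \<in> S \<and> u \<notin> P \<and> s i = x ^ m * u" using x(3) s(1) unfolding I_def by blast
  then obtain m u where mu: "\<And>i. i \<in> I \<Longrightarrow> u i \<in> S \<and> u i \<notin> P \<and> s i = x ^ m i * u i" by metis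
  define M where "M = Min (m ` I)"
  have M: "M \<le> m i" if "i \<in> I" for i using that I unfolding M_def by auto
  have "M \<in> m ` I" unfolding M_def using I by (intro Min_in) auto
  then obtain j where j: "j \<in> I" "m j = M" by auto
  define s' where "s' i = (if i \<in> I then x ^ (m i - M) * u i else 0)" for i
  have pow_S: "x ^ k \<in> S" for k by (induction k) (auto simp: poly_values_closed x(1))
  have eq: "s i = x ^ M * s' i" if "i \<le> d" for i
  proof (cases "i \<in> I")
    case True
    then have "x ^ m i = x ^ M * x ^ (m i - M)" using M by (simp flip: power_add)
    then show ?thesis using mu True unfolding s'_def by (simp add: mult.assoc)
  qed (use that in \<open>auto simp: I_def s'_def\<close>)
  have "x ^ M * (\<Sum>i\<le>d. s' i * w i) = (\<Sum>i\<le>d. s i * w i)"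
    unfolding sum_distrib_left by (intro sum.cong) (auto simp: eq mult_ac)
  then have "(\<Sum>i\<le>d. s' i * w i) = 0" using s(3) x(2) by simp
  moreover have "s' i \<in> S" for i unfolding s'_def using mu pow_S poly_values_closed by auto
  moreover have "s' j \<notin> P" "j \<le> d" using mu j unfolding s'_def by (auto simp: I_def)
  ultimately show ?thesis by blast
qed

text \<open>
  This bounds the ramification by \<open>d\<close>. In a primitive relation among the \<open>w i\<close> let \<open>s j\<close> be the last
  coefficient outside \<open>P\<close>. After division by \<open>w j\<close> all other terms lie in \<open>P\<close>: those before because
  \<open>w i / w j\<close> does, those after because their coefficients are multiples of \<open>x\<close>,
  while \<open>x / w j\<close> is regular and \<open>w i\<close> lies in \<open>P\<close>.
  Then \<open>s j\<close> lies in \<open>P\<close> as well.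
\<close>

lemma no_long_chain:
  assumes x: "x \<in> P" "x \<noteq> 0" "\<And>s. s \<in> S \<Longrightarrow> s \<in> P \<Longrightarrow> \<exists>s'\<in>S. s = x * s'"
    and w: "\<And>i. i \<le> d \<Longrightarrow> w i \<in> P" "\<And>i. i \<le> d \<Longrightarrow> w i \<noteq> 0" "\<And>i. i \<le> d \<Longrightarrow> x / w i \<in> V"
      "\<And>i j. i < j \<Longrightarrow> j \<le> d \<Longrightarrow> w i / w j \<in> P"
  shows False
proof -
  obtain s where s: "\<And>i. i \<le> d \<Longrightarrow> s i \<in> S" "\<exists>i\<le>d. s i \<notin> P" "(\<Sum>i\<le>d. s i * w i) = 0"
    using primitive_relation[of w] by blast
  define J where "J = {i. i \<le> d \<and> s i \<notin> P}"
  have J: "finite J" "J \<noteq> {}" using s(2) unfolding J_def by auto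
  define j where "j = Max J"
  have j: "j \<le> d" "s j \<notin> P" using Max_in[OF J] unfolding j_def J_def by auto
  have above: "s i \<in> P" if "j < i" "i \<le> d" for i
    using Max_ge[OF J(1), of i] that unfolding j_def by (metis J_def leD mem_Collect_eq)
  have "(\<Sum>i\<in>{..d} - {j}. s i * w i / w j) \<in> P"
  proof (rule P_sum)
    fix i assume i: "i \<in> {..d} - {j}"
    show "s i * w i / w j \<in> P"
    proof (cases "i < j")
      case True
      have "s i * (w i / w j) \<in> P"
        using S_subset_V[OF s(1)] i w(4)[OF True j(1)] by (intro P_closed(6)) auto
      then show ?thesis by simp
    next
      case False
      then have "j < i" "i \<le> d" using i by auto
      then obtain g where g: "g \<in> S" "s i = x * g" using x(3)[OF s(1) above] by blast
      have "g * w i \<in> P" using S_subset_V[OF g(1)] w(1)[of i] i by (intro P_closed(6)) auto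
      then have "(x / w j) * (g * w i) \<in> P" using w(3)[OF j(1)] by (rule P_closed(6)[rotated])
      then show ?thesis using g(2) by (simp add: mult_ac)
    qed
  qed
  moreover have "s j = - (\<Sum>i\<in>{..d} - {j}. s i * w i / w j)"
  proof -
    have "s j * w j + (\<Sum>i\<in>{..d} - {j}. s i * w i) = 0"
      using s(3) j(1) by (subst (asm) sum.remove[of _ j]) auto
    then have "s j = - (\<Sum>i\<in>{..d} - {j}. s i * w i) / w j"
      using w(2)[OF j(1)] by (simp add: field_simps add_eq_0_iff2)
    then show ?thesis by (simp add: sum_divide_distrib)
  qed
  ultimately show False using P_closed(4) j(2) by metis
qed

text \<open>
  If no element generated \<open>P\<close>, each one would have a proper divisor in \<open>P\<close>, and \<open>x\<close> would start a chain of
  unlimited length.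
\<close>

lemma place_principal:
  obtains t where "t \<in> P" "t \<noteq> 0" "\<And>z. z \<in> P \<Longrightarrow> z / t \<in> V"
proof (rule ccontr)
  assume no: "\<not> thesis"
  obtain x where x: "x \<in> P" "x \<noteq> 0" "\<And>s. s \<in> S \<Longrightarrow> s \<in> P \<Longrightarrow> \<exists>s'\<in>S. s = x * s'"
    by (rule local_parameter_of_S) (rule that; blast)
  have "\<forall>t. \<exists>z. t \<in> P \<and> t \<noteq> 0 \<longrightarrow> z \<in> P \<and> z / t \<notin> V" using that no by blast
  then obtain nxt where nxt: "\<And>t. t \<in> P \<Longrightarrow> t \<noteq> 0 \<Longrightarrow> nxt t \<in> P \<and> nxt t / t \<notin> V" by metis
  \<comment> \<open>Dividing properly again and again, starting from \<open>x\<close>.\<close>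
  define w where "w i = (nxt ^^ i) x" for i
  have w: "w i \<in> P \<and> w i \<noteq> 0" for i
  proof (induction i)
    case (Suc i)
    have "nxt (w i) \<noteq> 0" using nxt[of "w i"] Suc V_closed(1) by auto
    then show ?case using nxt[of "w i"] Suc unfolding w_def by auto
  qed (use x w_def in auto)
  have step: "w i / w (Suc i) \<in> P" for i
    using nxt[of "w i"] w[of i] quotient_in_P[of "w (Suc i)" "w i"] unfolding w_def by auto
  have chain: "w i / w j \<in> P" if "i < j" for i j
    using that
  proof (induction rule: less_Suc_induct)
    case (2 i j k)
    have "(w i / w j) * (w j / w k) \<in> P" using 2 P_subset_V by (intro P_closed(5))
    then show ?case using w[of j] by simp
  qed (rule step)
  have "x / w i \<in> V" for i
    using chain[of 0 i] x(2) V_closed(2) P_subset_V by (cases i) (auto simp: w_def)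
  then show False using no_long_chain[OF x, of w] w chain by blast
qed

text \<open>
  Suppose that all powers of \<open>t\<close> divide \<open>z\<close>. Some nonzero element of \<open>K[y]\<close> is a multiple of \<open>z\<close>,
  and up to a unit it is a power of \<open>x\<close>. So they all divide this power, and
  by integral closedness \<open>x\<close> itself. Then the powers of \<open>t\<close> form a chain that is too long.
\<close>

lemma bounded_division_by_powers:
  assumes t: "t \<in> P" "t \<noteq> 0" and z: "z \<in> V" "z \<noteq> 0"
  shows "\<exists>k. z / t ^ k \<notin> V"
proof (rule ccontr)
  assume "\<not> ?thesis"
  then have div: "z / t ^ k \<in> V" for k by blast
  obtain x where x: "x \<in> P" "x \<noteq> 0" "\<And>s. s \<in> S \<Longrightarrow> s \<in> P \<Longrightarrow> \<exists>s'\<in>S. s = x * s'"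
    and unit: "\<And>s. s \<in> S \<Longrightarrow> s \<noteq> 0 \<Longrightarrow> \<exists>m. \<exists>s'\<in>S. s' \<notin> P \<and> s = x ^ m * s'"
    by (rule local_parameter_of_S) (rule that; blast)
  obtain s where s: "s \<in> S" "s \<noteq> 0" "s / z \<in> V" using multiple_in_S[OF z] by blast
  obtain m u where u: "u \<in> S" "u \<notin> P" "s = x ^ m * u" using unit[OF s(1,2)] by blast
  have iu: "u \<noteq> 0" "inverse u \<in> V" using unit_inverse[OF S_subset_V[OF u(1)] u(2)] by auto
  have xm: "x ^ m / t ^ k \<in> V" for k
  proof -
    have "(s / z) * (z / t ^ k) * inverse u \<in> V" using s(3) div iu(2) by (intro V_closed(5))
    moreover have "(s / z) * (z / t ^ k) * inverse u = x ^ m / t ^ k"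
      using u(3) iu(1) z(2) t(2) by (simp add: field_simps)
    ultimately show ?thesis by metis
  qed
  have t_pow: "t ^ Suc k \<in> P" for k
    using P_closed(5)[OF t(1) V_power[OF P_subset_V[OF t(1)], of k]] by simp
  have "m \<noteq> 0"
  proof
    assume "m = 0"
    then have "t * (1 / t) \<in> P" using xm[of 1] t(1) by (intro P_closed(5)) auto
    then show False using t(2) P_closed(2) by simp
  qed
  have xt: "x / t ^ k \<in> V" for k
    using V_integrally_closed[of "x / t ^ k" m] xm[of "k * m"] \<open>m \<noteq> 0\<close>
    by (simp add: power_divide power_mult)
  show False
  proof (rule no_long_chain[OF x, of "\<lambda>i. t ^ (Suc d - i)"])
    fix i assume "i \<le> d"
    then show "t ^ (Suc d - i) \<in> P" using t_pow[of "d - i"] by (simp add: Suc_diff_le)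
    show "t ^ (Suc d - i) \<noteq> 0" using t(2) by simp
    show "x / t ^ (Suc d - i) \<in> V" by (rule xt)
  next
    fix i j assume ij: "i < j" "j \<le> d"
    then have "Suc d - i = (Suc d - j) + Suc (j - Suc i)" by simp
    then have "t ^ (Suc d - i) = t ^ (Suc d - j) * t ^ Suc (j - Suc i)" by (simp only: power_add)
    then have "t ^ (Suc d - i) / t ^ (Suc d - j) = t ^ Suc (j - Suc i)" using t(2) by simp
    then show "t ^ (Suc d - i) / t ^ (Suc d - j) \<in> P" using t_pow by metis
  qed
qed

text \<open>
  Call a family independent if it is so modulo \<open>P\<close> over \<open>K[y]\<close>. A primitive relation limits its size
  to \<open>d\<close>. Relative to a largest family \<open>w\<close>, every regular \<open>v\<close> enters a relation modulo \<open>P\<close> in which its own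
  coefficient is a unit, and solving for \<open>v\<close> modulo \<open>P\<close> leaves only finitely many possibilities, because the
  coefficients may be taken from the finite set \<open>A\<close> of representatives.
\<close>

lemma finite_residues: "\<exists>A. finite A \<and> A \<subseteq> V \<and> (\<forall>w\<in>V. \<exists>a\<in>A. w - a \<in> P)"
proof -
  obtain A where A: "finite A" "A \<subseteq> S" "\<And>s. s \<in> S \<Longrightarrow> \<exists>a\<in>A. s - a \<in> P"
    by (rule local_parameter_of_S) (rule that; (assumption | metis))
  define ind where "ind m w \<longleftrightarrow> (\<forall>i<m. w i \<in> V) \<and>
    (\<forall>s. (\<forall>i<m. s i \<in> S) \<and> (\<Sum>i<m. s i * w i) \<in> P \<longrightarrow> (\<forall>i<m. s i \<in> P))" for m :: nat and w :: "nat \<Rightarrow> 'f"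
  have indD: "\<forall>i<m. s i \<in> P" if "ind m w" "\<forall>i<m. s i \<in> S" "(\<Sum>i<m. s i * w i) \<in> P" for m w s
    using that(1)[unfolded ind_def, THEN conjunct2, rule_format, of s] that(2,3) by blast
  have bound: "m \<le> d" if ind: "ind m w" for m w
  proof (rule ccontr)
    assume "\<not> m \<le> d"
    then have "d < m" by simp
    obtain s where s: "\<forall>i\<le>d. s i \<in> S" "\<exists>i\<le>d. s i \<notin> P" "(\<Sum>i\<le>d. s i * w i) = 0"
      using primitive_relation[of w] by blast
    let ?s = "\<lambda>i. if i \<le> d then s i else 0"
    have "(\<Sum>i<m. ?s i * w i) = (\<Sum>i\<le>d. s i * w i)"
      using \<open>d < m\<close> by (intro sum.mono_neutral_cong_right) auto
    then have "(\<Sum>i<m. ?s i * w i) \<in> P" using s(3) P_closed(1) by simp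
    moreover have "\<forall>i<m. ?s i \<in> S" using s(1) poly_values_closed(1) by auto
    ultimately have "\<forall>i<m. ?s i \<in> P" by (intro indD[OF ind])
    moreover obtain i where "i \<le> d" "s i \<notin> P" using s(2) by blast
    ultimately show False using \<open>d < m\<close> by (auto dest: spec[of _ i])
  qed
  have "ind 0 w" for w unfolding ind_def by simp
  then have "\<exists>w. ind 0 w" by blast
  then obtain m where m: "\<exists>w. ind m w" "\<And>k. \<exists>w. ind k w \<Longrightarrow> k \<le> m"
    using Nat.ex_has_greatest_nat[of "\<lambda>m. \<exists>w. ind m w" 0 d] bound by (metis)
  then obtain w where w: "ind m w" by blast
  have wV: "w i \<in> V" if "i < m" for i using w that unfolding ind_def by blast
  \<comment> \<open>The solutions for \<open>v\<close> of the relations with coefficients from \<open>A\<close>.\<close>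
  define B where "B = (\<lambda>(a, f). - (\<Sum>i<m. f i * w i) / a) ` ((A - P) \<times> ({..<m} \<rightarrow>\<^sub>E A))"
  have "finite B" unfolding B_def using A(1) by (intro finite_imageI finite_cartesian_product finite_PiE) auto
  moreover have "B \<subseteq> V"
  proof
    fix b assume "b \<in> B"
    then obtain a f where af: "a \<in> A" "a \<notin> P" "f \<in> {..<m} \<rightarrow>\<^sub>E A" "b = - (\<Sum>i<m. f i * w i) * inverse a"
      unfolding B_def by (auto simp: divide_inverse)
    have "inverse a \<in> V" using unit_inverse af(1,2) A(2) S_subset_V by blast
    moreover have "(\<Sum>i<m. f i * w i) \<in> V"
      using af(3) A(2) S_subset_V wV by (intro V_sum V_closed(5)) (auto dest: PiE_mem)
    ultimately show "b \<in> V" unfolding af(4) by (intro V_closed)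
  qed
  moreover have "\<exists>b\<in>B. v - b \<in> P" if v: "v \<in> V" for v
  proof -
    let ?w = "w(m := v)"
    have "\<not> ind (Suc m) ?w" using m(2) by fastforce
    moreover have "\<forall>i<Suc m. ?w i \<in> V" using v wV by auto
    ultimately obtain s where s: "\<And>i. i < Suc m \<Longrightarrow> s i \<in> S" "(\<Sum>i<Suc m. s i * ?w i) \<in> P" "\<exists>i<Suc m. s i \<notin> P"
      unfolding ind_def by blast
    have sum: "(\<Sum>i<m. s i * w i) + s m * v \<in> P" using s(2) by simp
    have "s m \<notin> P"
    proof
      assume "s m \<in> P"
      then have "(\<Sum>i<m. s i * w i) \<in> P" using P_diff[OF sum P_closed(5)[OF _ v, of "s m"]] by simp
      then have "\<forall>i<m. s i \<in> P" using s(1) by (intro indD[OF w]) auto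
      then show False using s(3) \<open>s m \<in> P\<close> by (metis less_Suc_eq)
    qed
    have "\<forall>i. \<exists>a. i < Suc m \<longrightarrow> a \<in> A \<and> s i - a \<in> P" using A(3) s(1) by blast
    then obtain f where f: "\<And>i. i < Suc m \<Longrightarrow> f i \<in> A \<and> s i - f i \<in> P" by metis
    have fm: "f m \<notin> P"
    proof
      assume "f m \<in> P"
      then have "(s m - f m) + f m \<in> P" using f[of m] by (intro P_closed(3)) auto
      then show False using \<open>s m \<notin> P\<close> by simp
    qed
    let ?b = "- (\<Sum>i<m. restrict f {..<m} i * w i) / f m"
    have "?b \<in> B" unfolding B_def
      using f fm by (intro image_eqI[of _ _ "(f m, restrict f {..<m})"]) auto
    moreover have "v - ?b \<in> P"
    proof -
      have fmV: "f m \<noteq> 0" "inverse (f m) \<in> V" using unit_inverse[of "f m"] fm f[of m] A(2) S_subset_V by blast+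
      have "(\<Sum>i<m. (s i - f i) * w i) + (s m - f m) * v \<in> P"
        using f wV v by (intro P_closed(3) P_sum P_closed(5)) auto
      then have "((\<Sum>i<m. s i * w i) + s m * v) - ((\<Sum>i<m. (s i - f i) * w i) + (s m - f m) * v) \<in> P"
        by (rule P_diff[OF sum])
      then have "(\<Sum>i<m. f i * w i) + f m * v \<in> P" by (simp add: algebra_simps sum_subtractf)
      then have "((\<Sum>i<m. f i * w i) + f m * v) * inverse (f m) \<in> P" using fmV(2) by (rule P_closed(5))
      moreover have "(\<Sum>i<m. restrict f {..<m} i * w i) = (\<Sum>i<m. f i * w i)" by (intro sum.cong) auto
      ultimately show ?thesis using fmV(1) by (simp add: field_simps)
    qed
    ultimately show ?thesis by blast
  qed
  ultimately show ?thesis by blast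
qed

end

section \<open>The discrete valuation\<close>

context function_field_place
begin

lemma exists_bounded: "\<exists>y d. function_field_place_bounded K P y d"
proof (rule bounded_relations[OF function_field])
  fix x :: 'f and d :: nat assume rel: "\<And>y w. x = y \<or> x = inverse y \<Longrightarrow>
    \<exists>s. (\<forall>i\<le>d. s i \<in> poly_values K y) \<and> (\<exists>i\<le>d. s i \<noteq> 0) \<and> (\<Sum>i\<le>d. s i * w i) = 0"
  obtain y where y: "y \<in> V" "x = y \<or> x = inverse y"
    using V_total[of x] by (metis inverse_inverse_eq)
  have "function_field_place_bounded K P y d"
    by unfold_locales (rule y(1), rule rel[OF y(2)])
  then show ?thesis by blast
qed

lemma uniformizer_exists:
  obtains t where "t \<in> P" "t \<noteq> 0" "\<And>z. z \<in> P \<Longrightarrow> z / t \<in> V"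
proof -
  obtain y d where "function_field_place_bounded K P y d" using exists_bounded by blast
  then interpret function_field_place_bounded K P y d .
  show thesis by (rule place_principal) (rule that)
qed

lemma division_by_powers_stops:
  assumes "t \<in> P" "t \<noteq> 0" "z \<in> V" "z \<noteq> 0"
  shows "\<exists>k. z / t ^ k \<notin> V"
proof -
  obtain y d where "function_field_place_bounded K P y d" using exists_bounded by blast
  then interpret function_field_place_bounded K P y d .
  show ?thesis using assms by (rule bounded_division_by_powers)
qed

lemma finitely_many_residues: "\<exists>A. finite A \<and> A \<subseteq> V \<and> (\<forall>w\<in>V. \<exists>a\<in>A. w - a \<in> P)"
proof -
  obtain y d where "function_field_place_bounded K P y d" using exists_bounded by blast
  then interpret function_field_place_bounded K P y d .
  show ?thesis by (rule finite_residues)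
qed

definition unit :: "'f \<Rightarrow> bool"
  where "unit u \<longleftrightarrow> u \<in> V \<and> u \<notin> P"

lemma unit_mult: "unit u \<Longrightarrow> unit v \<Longrightarrow> unit (u * v)"
  unfolding unit_def using P_prime V_closed(5) by blast

lemma unit_inv: "unit u \<Longrightarrow> unit (inverse u)"
  unfolding unit_def using unit_inverse by blast

lemma unit_powi: "unit u \<Longrightarrow> unit (u powi m)"
proof -
  have pow: "unit (v ^ k)" if "unit v" for v k
  proof (induction k)
    case 0
    show ?case using V_closed(2) P_closed(2) by (simp add: unit_def)
  qed (simp add: unit_mult that)
  assume "unit u"
  then show ?thesis unfolding power_int_def using pow unit_inv by auto
qed

lemma uniformizer_factorization_V:
  assumes t: "t \<in> P" "t \<noteq> 0" "\<And>z. z \<in> P \<Longrightarrow> z / t \<in> V" and z: "z \<in> V" "z \<noteq> 0"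
  shows "\<exists>k::nat. \<exists>u. unit u \<and> z = t ^ k * u"
proof -
  \<comment> \<open>At the last exponent before division fails, the quotient is a unit, since \<open>t\<close> generates \<open>P\<close>.\<close>
  define k where "k = (LEAST k. z / t ^ k \<notin> V)"
  have k: "z / t ^ k \<notin> V" using LeastI_ex[OF division_by_powers_stops[OF t(1,2) z]] unfolding k_def .
  then have "k \<noteq> 0" using z by (cases k) auto
  then obtain l where l: "k = Suc l" by (cases k) auto
  have "z / t ^ l \<in> V" using not_less_Least[of l "\<lambda>k. z / t ^ k \<notin> V"] l unfolding k_def by auto
  moreover have "z / t ^ l \<notin> P"
  proof
    assume "z / t ^ l \<in> P"
    then have "z / t ^ l / t \<in> V" by (rule t(3))
    then show False using k l by (simp add: divide_divide_eq_left mult.commute)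
  qed
  ultimately have "unit (z / t ^ l)" unfolding unit_def by blast
  then show ?thesis using t(2) by (intro exI[of _ l] exI[of _ "z / t ^ l"]) auto
qed

lemma uniformizer_factorization:
  assumes t: "t \<in> P" "t \<noteq> 0" "\<And>z. z \<in> P \<Longrightarrow> z / t \<in> V" and z: "z \<noteq> 0"
  shows "\<exists>m::int. \<exists>u. unit u \<and> z = t powi m * u"
proof (cases "z \<in> V")
  case True
  then obtain k u where "unit u" "z = t ^ k * u" using uniformizer_factorization_V[OF t] z by blast
  then show ?thesis by (intro exI[of _ "int k"] exI[of _ u]) auto
next
  case False
  then have "inverse z \<in> V" "inverse z \<noteq> 0" using V_total z by auto
  then obtain k u where ku: "unit u" "inverse z = t ^ k * u" using uniformizer_factorization_V[OF t] by metis
  then have "z = inverse (t ^ k * u)" by (metis inverse_inverse_eq)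
  then have "z = t powi (- int k) * inverse u" by (simp add: power_int_minus)
  then show ?thesis using unit_inv[OF ku(1)] by blast
qed

lemma powi_unit_imp_zero:
  assumes "t \<in> P" "unit (t powi k)"
  shows "k = 0"
proof (rule ccontr)
  assume "k \<noteq> 0"
  have pos: "\<not> unit (t ^ n)" if "n > 0" for n
    using P_closed(5)[OF assms(1) V_power[OF P_subset_V[OF assms(1)], of "n - 1"]] that
    by (cases n) (auto simp: unit_def)
  show False
  proof (cases "k > 0")
    case True
    then show False using pos[of "nat k"] assms(2) by (simp add: power_int_def)
  next
    case False
    then have "unit (t powi (- k))" using unit_inv[OF assms(2)] by (simp add: power_int_minus)
    then show False using pos[of "nat (- k)"] False \<open>k \<noteq> 0\<close> by (simp add: power_int_def)
  qed
qed

lemma Units_place_ring: "u \<in> Units (place_ring P) \<longleftrightarrow> unit u"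
proof
  assume "u \<in> Units (place_ring P)"
  then obtain v where v: "u \<in> V" "v \<in> V" "u * v = 1" by (auto simp: Units_def place_ring_eq)
  then have "u \<notin> P" using P_closed(2,5) by metis
  then show "unit u" using v(1) unfolding unit_def by blast
next
  assume u: "unit u"
  then have "u \<noteq> 0" "inverse u \<in> V" "u \<in> V" using unit_inverse unfolding unit_def by blast+
  then show "u \<in> Units (place_ring P)"
    by (auto simp: Units_def place_ring_eq intro!: bexI[of _ "inverse u"])
qed

lemma generator_iff:
  "P = (\<lambda>x. t * x) ` carrier (place_ring P) \<longleftrightarrow> t \<in> P \<and> t \<noteq> 0 \<and> (\<forall>z\<in>P. z / t \<in> V)"
proof
  assume P: "P = (\<lambda>x. t * x) ` carrier (place_ring P)"
  have "t * 1 \<in> (\<lambda>x. t * x) ` V" using V_closed(2) by blast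
  then have tP: "t \<in> P" using P V_def by simp
  have t0: "t \<noteq> 0"
  proof
    assume "t = 0"
    then have "P \<subseteq> {0}" using P by auto
    then show False using uniformizer_exists by blast
  qed
  moreover have "z / t \<in> V" if z: "z \<in> P" for z
  proof -
    obtain v where "v \<in> V" "z = t * v" using z P V_def by blast
    then show ?thesis using t0 by simp
  qed
  ultimately show "t \<in> P \<and> t \<noteq> 0 \<and> (\<forall>z\<in>P. z / t \<in> V)" using tP by blast
next
  assume t: "t \<in> P \<and> t \<noteq> 0 \<and> (\<forall>z\<in>P. z / t \<in> V)"
  show "P = (\<lambda>x. t * x) ` carrier (place_ring P)"
  proof
    show "P \<subseteq> (\<lambda>x. t * x) ` carrier (place_ring P)"
    proof
      fix z assume "z \<in> P"
      then have "z / t \<in> V" "z = t * (z / t)" using t by auto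
      then show "z \<in> (\<lambda>x. t * x) ` carrier (place_ring P)" unfolding V_def by blast
    qed
    show "(\<lambda>x. t * x) ` carrier (place_ring P) \<subseteq> P"
      using t P_closed(5) unfolding V_def[symmetric] by blast
  qed
qed

text \<open>
  The valuation is a definite description over all generators of \<open>P\<close>. Two of them differ by a unit, so they give the same exponent.
\<close>

lemma place_val_eqI:
  assumes t: "t \<in> P" "t \<noteq> 0" "\<And>z. z \<in> P \<Longrightarrow> z / t \<in> V" and u: "unit u"
  shows "place_val P (t powi m * u) = m"
  unfolding place_val_def
proof (rule the_equality)
  show "\<exists>s. P = (\<lambda>x. s * x) ` carrier (place_ring P) \<and> (\<exists>v\<in>Units (place_ring P). t powi m * u = s powi m * v)"
    using t u generator_iff[of t] Units_place_ring by blast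
next
  fix m' assume "\<exists>s. P = (\<lambda>x. s * x) ` carrier (place_ring P) \<and> (\<exists>v\<in>Units (place_ring P). t powi m * u = s powi m' * v)"
  then obtain s v where s: "s \<in> P" "s \<noteq> 0" "\<And>z. z \<in> P \<Longrightarrow> z / s \<in> V"
    and v: "unit v" "t powi m * u = s powi m' * v"
    using generator_iff Units_place_ring by blast
  define r where "r = s / t"
  have r: "unit r"
  proof -
    have "r \<in> V" "inverse r \<in> V" "r \<noteq> 0" unfolding r_def using t s by auto
    then show ?thesis unfolding unit_def using P_iff by blast
  qed
  have "s = t * r" unfolding r_def using t(2) by simp
  then have "t powi m * u = t powi m' * (r powi m' * v)" using v(2) by (simp add: power_int_mult_distrib mult.assoc)
  moreover have "u \<noteq> 0" using u P_closed(1) unfolding unit_def by auto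
  ultimately have "t powi (m - m') = r powi m' * v * inverse u"
    using t(2) by (simp add: power_int_diff field_simps)
  then have "unit (t powi (m - m'))" using r v(1) u by (simp add: unit_mult unit_powi unit_inv)
  then show "m' = m" using powi_unit_imp_zero[OF t(1)] by fastforce
qed

lemma place_val_nonneg_imp:
  assumes "z \<noteq> 0" "place_val P z \<ge> 0"
  shows "z \<in> V"
proof -
  obtain t where t: "t \<in> P" "t \<noteq> 0" "\<And>z. z \<in> P \<Longrightarrow> z / t \<in> V" by (rule uniformizer_exists) (rule that; blast)
  obtain m u where u: "unit u" "z = t powi m * u" using uniformizer_factorization[OF t assms(1)] by blast
  then have "m \<ge> 0" using place_val_eqI[OF t u(1)] assms(2) by simp
  then have "z = t ^ nat m * u" using u(2) by (simp add: power_int_def)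
  then show ?thesis using u(1) V_power[OF P_subset_V[OF t(1)]] V_closed(5) unfolding unit_def by simp
qed

section \<open>Residue classes and values\<close>

lemma residue_alt: "residue P f = (\<lambda>p. p + f) ` P"
  unfolding residue_def a_r_coset_def r_coset_def by (auto simp: place_ring_eq)

lemma residue_eq_iff: "residue P f = residue P h \<longleftrightarrow> f - h \<in> P"
proof
  assume "residue P f = residue P h"
  moreover have "f \<in> residue P f" unfolding residue_alt using P_closed(1) by (auto intro: image_eqI[of _ _ 0])
  ultimately show "f - h \<in> P" unfolding residue_alt by auto
next
  assume fh: "f - h \<in> P"
  have "residue P f \<subseteq> residue P h" if "f - h \<in> P" for f h
  proof
    fix z assume "z \<in> residue P f"
    then obtain p where "p \<in> P" "z = p + f" unfolding residue_alt by blast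
    then have "p + (f - h) \<in> P" "z = (p + (f - h)) + h" using that P_closed(3) by auto
    then show "z \<in> residue P h" unfolding residue_alt by blast
  qed
  moreover have "h - f \<in> P" using P_closed(4)[OF fh] by simp
  ultimately show "residue P f = residue P h" using fh by blast
qed

lemma carrier_residue_field: "carrier (residue_field P) = residue P ` V"
  unfolding residue_field_def FactRing_simps residue_def a_r_coset_def[symmetric]
  by (auto simp: place_ring_eq)

text \<open>
  The coset \<open>residue P f\<close> is formed for every \<open>f\<close> in the function field, but is an element of the residue class
  field for regular \<open>f\<close> only. So surjectivity of \<open>Ev\<^sub>Q\<close> onto the residue class field contains the
  information that \<open>\<L>(D)\<close> consists of functions regular at \<open>Q\<close>.
\<close>

lemma residue_in_carrier_iff: "residue P f \<in> carrier (residue_field P) \<longleftrightarrow> f \<in> V"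
proof
  assume "residue P f \<in> carrier (residue_field P)"
  then obtain h where "h \<in> V" "f - h \<in> P" unfolding carrier_residue_field using residue_eq_iff by blast
  then have "(f - h) + h \<in> V" using P_subset_V V_closed(3) by blast
  then show "f \<in> V" by simp
qed (simp add: carrier_residue_field)

lemma residue_zero_iff: "residue P f = \<zero>\<^bsub>residue_field P\<^esub> \<longleftrightarrow> f \<in> P"
proof -
  have "\<zero>\<^bsub>residue_field P\<^esub> = residue P 0" unfolding residue_field_def FactRing_def residue_alt by simp
  then show ?thesis using residue_eq_iff[of f 0] by simp
qed

lemma residue_hom: "ring_hom_ring (place_ring P) (residue_field P) (residue P)"
proof -
  have "ideal P (place_ring P)" using P_maximal unfolding place_ring_eq by (rule maximalideal.axioms(1))
  then have "ring_hom_ring (place_ring P) (residue_field P) ((+>\<^bsub>place_ring P\<^esub>) P)"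
    unfolding residue_field_def by (rule ideal.rcos_ring_hom_ring)
  moreover have "(+>\<^bsub>place_ring P\<^esub>) P = residue P" unfolding residue_def by auto
  ultimately show ?thesis by simp
qed

lemma residue_combine:
  assumes "length as = length fs" "set as \<subseteq> K" "set fs \<subseteq> V"
  shows "ring.combine (residue_field P) (map (residue P) as) (map (residue P) fs)
    = residue P (\<Sum>i<length fs. as ! i * fs ! i)"
proof -
  interpret H: ring_hom_ring "place_ring P" "residue_field P" "residue P" by (rule residue_hom)
  show ?thesis using assms
  proof (induction as fs rule: list_induct2)
    case Nil
    show ?case using residue_zero_iff[of 0] P_closed(1) by simp
  next
    case (Cons a as f fs)
    have "as ! i \<in> V" if "i < length fs" for i
    proof -
      have "as ! i \<in> set as" using that Cons.hyps by simp
      then show ?thesis using Cons.prems(1) K_subset_V by auto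
    qed
    then have mem: "a \<in> V" "f \<in> V" "(\<Sum>i<length fs. as ! i * fs ! i) \<in> V"
      using Cons.prems K_subset_V by (auto intro!: V_sum V_closed(5))
    have "residue P (a * f + (\<Sum>i<length fs. as ! i * fs ! i))
      = residue P a \<otimes>\<^bsub>residue_field P\<^esub> residue P f \<oplus>\<^bsub>residue_field P\<^esub> residue P (\<Sum>i<length fs. as ! i * fs ! i)"
      using mem V_closed(5) H.hom_add[of "a * f" "\<Sum>i<length fs. as ! i * fs ! i"] H.hom_mult[of a f]
      by (simp add: place_ring_eq)
    then show ?case using Cons by (simp add: sum.lessThan_Suc_shift del: sum.lessThan_Suc)
  qed
qed

text \<open>
  The dimension that defines \<open>place_degree\<close> is a definite description, meaningful in finite dimension only. As
  there are finitely many residue classes, the residue class field is finite-dimensional over the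
  constants, and dimension one makes \<open>1\<close> a basis of it.
\<close>

lemma degree_one_residue:
  assumes deg: "place_degree K P = 1" and f: "f \<in> V"
  shows "\<exists>a\<in>K. f - a \<in> P"
proof -
  interpret H: ring_hom_ring "place_ring P" "residue_field P" "residue P" by (rule residue_hom)
  let ?R = "residue_field P"
  let ?k = "residue P ` K"
  have "subfield K (place_ring P)"
  proof -
    interpret F: field "FF :: 'f ring" by (rule FF_field)
    have "field (FF\<lparr>carrier := K\<rparr>)" by (rule F.subfield_iff(2)[OF subfield])
    then have "field ((place_ring P)\<lparr>carrier := K\<rparr>)" by (simp add: place_ring_eq)
    then show ?thesis using H.R.subfield_iff(1) K_subset_V by (auto simp: place_ring_eq)
  qed
  moreover have one_zero: "\<one>\<^bsub>?R\<^esub> \<noteq> \<zero>\<^bsub>?R\<^esub>"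
    using H.hom_one residue_zero_iff[of 1] P_closed(2) by (simp add: place_ring_eq)
  ultimately have k: "subfield ?k ?R" by (rule H.img_is_subfield(2))
  obtain A where A: "finite A" "A \<subseteq> V" "\<forall>w\<in>V. \<exists>a\<in>A. w - a \<in> P" using finitely_many_residues by blast
  have "carrier ?R \<subseteq> residue P ` A"
    unfolding carrier_residue_field using A(3) residue_eq_iff by blast
  then have "finite (carrier ?R)" using A(1) finite_surj by blast
  then obtain Us where Us: "set Us = carrier ?R" using finite_list by blast
  have "H.S.Span ?k Us = carrier ?R"
    using H.S.Span_base_incl[OF k, of Us] H.S.Span_in_carrier[of ?k Us] subfieldE(3)[OF k] Us by blast
  then have "H.S.finite_dimension ?k (carrier ?R)"
    using H.S.Span_finite_dimension[OF k, of Us] Us by simp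
  then have dim: "H.S.dimension 1 ?k (carrier ?R)"
    using H.S.finite_dimensionE[OF k, of "carrier ?R"] deg unfolding over_def place_degree_def by simp
  have ind: "H.S.independent ?k [\<one>\<^bsub>?R\<^esub>]"
    by (rule H.S.independent.li_Cons) (use one_zero in auto)
  have "H.S.Span ?k [\<one>\<^bsub>?R\<^esub>] = carrier ?R"
    using H.S.independent_length_eq_dimension[OF k dim ind] by simp
  moreover have "H.S.Span ?k [\<one>\<^bsub>?R\<^esub>] = ?k"
    using H.S.independent_length_eq_dimension[OF k H.S.dimension_one[OF k] ind] subfieldE(1)[OF k, THEN subringE(3)] by simp
  ultimately have "residue P f \<in> ?k" using f residue_in_carrier_iff by blast
  then show ?thesis using residue_eq_iff by blast
qed

lemma value_at_eqI:
  assumes "a \<in> K" "f - a \<in> P"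
  shows "value_at K P f = a"
  unfolding value_at_def
proof (rule the_equality)
  have "a - f \<in> P" using P_closed(4)[OF assms(2)] by simp
  then show "a \<in> K \<and> residue P a = residue P f" using assms(1) residue_eq_iff by blast
  fix b assume b: "b \<in> K \<and> residue P b = residue P f"
  then have "(b - f) + (f - a) \<in> P" using residue_eq_iff assms(2) by (intro P_closed(3)) auto
  then have "b - a = 0" using K_inter_P[of "b - a"] K_diff b assms(1) by simp
  then show "b = a" by simp
qed

lemma value_at_properties:
  assumes "place_degree K P = 1" "f \<in> V"
  shows "value_at K P f \<in> K" "f - value_at K P f \<in> P"
  using degree_one_residue[OF assms] value_at_eqI by blast+

lemma value_at_linear_combination:
  assumes deg: "place_degree K P = 1" and c: "\<And>i. i \<in> I \<Longrightarrow> c i \<in> K" and f: "\<And>i. i \<in> I \<Longrightarrow> f i \<in> V"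
  shows "value_at K P (\<Sum>i\<in>I. c i * f i) = (\<Sum>i\<in>I. c i * value_at K P (f i))"
proof (rule value_at_eqI)
  show "(\<Sum>i\<in>I. c i * value_at K P (f i)) \<in> K"
    using c value_at_properties(1)[OF deg f] by (intro K_sum K_closed(5)) auto
  have "(\<Sum>i\<in>I. c i * (f i - value_at K P (f i))) \<in> P"
    using c value_at_properties(2)[OF deg f] K_subset_V by (intro P_sum P_closed(6)) auto
  then show "(\<Sum>i\<in>I. c i * f i) - (\<Sum>i\<in>I. c i * value_at K P (f i)) \<in> P"
    by (simp add: algebra_simps sum_subtractf)
qed

end

section \<open>Bases, coefficients and matrices\<close>

context finite_constant_field
begin

lemma basis_coefficients:
  assumes "is_basis FF K Us E"
  shows basis_span_iff: "v \<in> E \<longleftrightarrow> (\<exists>c. (\<forall>i<length Us. c i \<in> K) \<and> v = (\<Sum>i<length Us. c i * Us ! i))"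
    and basis_independent: "(\<forall>i<length Us. c i \<in> K) \<Longrightarrow> (\<Sum>i<length Us. c i * Us ! i) = 0 \<Longrightarrow> i < length Us \<Longrightarrow> c i = 0"
    and basis_dim: "ring.dim FF K E = length Us"
proof -
  interpret R: ring "FF :: 'f ring" by (rule FF_ring)
  have ind: "R.independent K Us" and span: "R.Span K Us = E" using assms unfolding is_basis_def by auto
  have mem: "v \<in> E \<longleftrightarrow> (\<exists>Ks. set Ks \<subseteq> K \<and> length Ks = length Us \<and> v = R.combine Ks Us)"
    using R.Span_mem_iff_length_version[OF subfield, of Us v] unfolding span by simp
  show "v \<in> E \<longleftrightarrow> (\<exists>c. (\<forall>i<length Us. c i \<in> K) \<and> v = (\<Sum>i<length Us. c i * Us ! i))"
  proof
    assume "v \<in> E"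
    then obtain Ks where Ks: "set Ks \<subseteq> K" "length Ks = length Us" "v = R.combine Ks Us"
      using mem by blast
    have "\<forall>i<length Us. Ks ! i \<in> K" using Ks(1,2) by (metis nth_mem subsetD)
    then show "\<exists>c. (\<forall>i<length Us. c i \<in> K) \<and> v = (\<Sum>i<length Us. c i * Us ! i)"
      using Ks(3) FF_combine[OF Ks(2)] by (intro exI[of _ "(!) Ks"]) auto
  next
    assume "\<exists>c. (\<forall>i<length Us. c i \<in> K) \<and> v = (\<Sum>i<length Us. c i * Us ! i)"
    then obtain c where c: "\<forall>i<length Us. c i \<in> K" "v = (\<Sum>i<length Us. c i * Us ! i)" by blast
    let ?Ks = "map c [0..<length Us]"
    have "set ?Ks \<subseteq> K" "length ?Ks = length Us" "v = R.combine ?Ks Us"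
      using c by (auto simp: FF_combine)
    then show "v \<in> E" using mem by blast
  qed
  show "c i = 0" if "\<forall>i<length Us. c i \<in> K" "(\<Sum>i<length Us. c i * Us ! i) = 0" "i < length Us"
  proof -
    let ?Ks = "map c [0..<length Us]"
    have "set ?Ks \<subseteq> K" "R.combine ?Ks Us = \<zero>\<^bsub>FF\<^esub>" using that by (auto simp: FF_combine)
    then have "set (take (length Us) ?Ks) \<subseteq> {0}"
      using R.independent_imp_trivial_combine[OF subfield ind, of ?Ks] by simp
    moreover have "c i \<in> set (take (length Us) ?Ks)" using that(3) by simp
    ultimately show ?thesis by blast
  qed
  show "ring.dim FF K E = length Us"
    using R.dimI[OF subfield R.dimensionI[OF subfield ind span]] unfolding over_def .
qed

end

lemma sum_append:
  fixes c :: "nat \<Rightarrow> 'a::comm_semiring_0"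
  shows "(\<Sum>i<length us + length vs. c i * (us @ vs) ! i) =
    (\<Sum>i<length us. c i * us ! i) + (\<Sum>i<length vs. c (length us + i) * vs ! i)"
proof -
  have "(\<Sum>i<length us + m. c i * (us @ vs) ! i) =
    (\<Sum>i<length us. c i * us ! i) + (\<Sum>i<m. c (length us + i) * vs ! i)" for m
    by (induction m) (auto simp: nth_append add.assoc)
  then show ?thesis .
qed

lemma finite_mats:
  assumes "finite K" shows "finite (mats K n)"
proof (rule finite_subset)
  show "mats K n \<subseteq> (\<lambda>f. mat n n f) ` ({..<n} \<times> {..<n} \<rightarrow>\<^sub>E K)"
  proof
    fix A assume A: "A \<in> mats K n"
    then have dim: "A \<in> carrier_mat n n" and K: "elements_mat A \<subseteq> K" unfolding mats_def by auto
    let ?f = "restrict (\<lambda>ij. A $$ ij) ({..<n} \<times> {..<n})"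
    have "A $$ (i, j) \<in> K" if "i < n" "j < n" for i j
      using K elements_matI[OF dim that refl] by blast
    then have "?f \<in> {..<n} \<times> {..<n} \<rightarrow>\<^sub>E K" by auto
    moreover have "A = mat n n ?f" using dim by (intro eq_matI) auto
    ultimately show "A \<in> (\<lambda>f. mat n n f) ` ({..<n} \<times> {..<n} \<rightarrow>\<^sub>E K)" by (metis image_eqI)
  qed
  show "finite ((\<lambda>f. mat n n f) ` ({..<n} \<times> {..<n} \<rightarrow>\<^sub>E K))"
    using assms by (intro finite_imageI finite_PiE) auto
qed

lemma finite_vecs:
  assumes "finite K" shows "finite {v \<in> carrier_vec n. \<forall>i<n. v $ i \<in> K}"
proof (rule finite_subset)
  show "{v \<in> carrier_vec n. \<forall>i<n. v $ i \<in> K} \<subseteq> (\<lambda>f. vec n f) ` ({..<n} \<rightarrow>\<^sub>E K)"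
  proof
    fix v assume v: "v \<in> {v \<in> carrier_vec n. \<forall>i<n. v $ i \<in> K}"
    let ?f = "restrict (\<lambda>i. v $ i) {..<n}"
    have "?f \<in> {..<n} \<rightarrow>\<^sub>E K" "v = vec n ?f" using v by (auto intro!: eq_vecI)
    then show "v \<in> (\<lambda>f. vec n f) ` ({..<n} \<rightarrow>\<^sub>E K)" by (metis image_eqI)
  qed
  show "finite ((\<lambda>f. vec n f) ` ({..<n} \<rightarrow>\<^sub>E K))"
    using assms by (intro finite_imageI finite_PiE) auto
qed

text \<open>
  The matrix lives over a large field, where its kernel is not under control. But it maps the finite set of vectors
  with entries in \<open>K\<close> injectively into itself, hence onto itself, and preimages of the unit
  vectors are the columns of an inverse. Without invertibility \<open>mat_inv T\<close> is an unspecified matrix, whose dimensions are unknown.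
\<close>

lemma mat_inv_carrier_if_injective:
  fixes T :: "'f::field mat"
  assumes T: "T \<in> carrier_mat N N" and fin: "finite K" and K: "0 \<in> K" "1 \<in> K"
    and closed: "\<And>v i. v \<in> carrier_vec N \<Longrightarrow> \<forall>i<N. v $ i \<in> K \<Longrightarrow> i < N \<Longrightarrow> (T *\<^sub>v v) $ i \<in> K"
    and inj: "inj_on ((*\<^sub>v) T) {v \<in> carrier_vec N. \<forall>i<N. v $ i \<in> K}"
  shows "mat_inv T \<in> carrier_mat N N"
proof -
  let ?KV = "{v \<in> carrier_vec N. \<forall>i<N. v $ i \<in> K}"
  have "(*\<^sub>v) T ` ?KV \<subseteq> ?KV" using T closed by auto
  then have surj: "(*\<^sub>v) T ` ?KV = ?KV" using endo_inj_surj[OF finite_vecs[OF fin] _ inj] by blast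
  have "\<exists>x. x \<in> carrier_vec N \<and> T *\<^sub>v x = unit_vec N j" if "j < N" for j
  proof -
    have "unit_vec N j \<in> ?KV" using K that by (auto simp: unit_vec_def)
    then have "unit_vec N j \<in> (*\<^sub>v) T ` ?KV" using surj by simp
    then show ?thesis by auto
  qed
  then obtain x where x: "\<And>j. j < N \<Longrightarrow> x j \<in> carrier_vec N \<and> T *\<^sub>v x j = unit_vec N j" by metis
  define Y where "Y = mat_of_cols N (map x [0..<N])"
  have Y: "Y \<in> carrier_mat N N" unfolding Y_def by (auto simp: mat_of_cols_def)
  have "T * Y = 1\<^sub>m N"
  proof (rule eq_matI)
    fix i j assume ij: "i < dim_row (1\<^sub>m N :: 'f mat)" "j < dim_col (1\<^sub>m N :: 'f mat)"
    then have "col Y j = x j" using x unfolding Y_def by (subst col_mat_of_cols) auto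
    then have "(T * Y) $$ (i, j) = (T *\<^sub>v x j) $ i" using ij T Y by simp
    then show "(T * Y) $$ (i, j) = 1\<^sub>m N $$ (i, j)" using x[of j] ij by (simp add: unit_vec_def)
  qed (use T Y in auto)
  moreover from this have "Y * T = 1\<^sub>m N" by (rule mat_mult_left_right_inverse[OF T Y])
  ultimately have "T \<in> Units (ring_mat TYPE('f) N ())" using T Y by (auto simp: Units_def ring_mat_def)
  then obtain B where B: "mat_inverse T = Some B" using mat_inverse(1)[OF T, where b = "()"] by (cases "mat_inverse T") auto
  then show ?thesis
    using mat_inverse(2)[OF T B] unfolding mat_inv_def by auto
qed

lemma argmax_argmin_complement:
  fixes f :: "'a \<Rightarrow> nat" and h :: "'a \<Rightarrow> int"
  assumes fin: "finite A" and ne: "A \<noteq> {}" and h: "\<And>x. x \<in> A \<Longrightarrow> h x = c - int (f x)"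
  shows "\<exists>x. is_arg_max f (\<lambda>x. x \<in> A) x"
    and "is_arg_max f (\<lambda>x. x \<in> A) x \<Longrightarrow> is_arg_min h (\<lambda>x. x \<in> A) x \<and> h x = Min (h ` A)"
    and "Min (h ` A) = c - int (Max (f ` A))"
proof -
  have min: "is_arg_min h (\<lambda>x. x \<in> A) x \<and> h x = Min (h ` A) \<and> f x = Max (f ` A)"
    if "is_arg_max f (\<lambda>x. x \<in> A) x" for x
  proof -
    have x: "x \<in> A" "\<And>y. y \<in> A \<Longrightarrow> f y \<le> f x" using that unfolding is_arg_max_def by (auto simp: not_less)
    have le: "h x \<le> h y" if "y \<in> A" for y using x(2)[OF that] h[OF that] h[OF x(1)] by simp
    have "Min (h ` A) = h x" using fin x(1) le by (intro Min_eqI) auto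
    moreover have "Max (f ` A) = f x" using fin x by (intro Max_eqI) auto
    ultimately show ?thesis using x(1) le unfolding is_arg_min_def by (auto simp: not_less)
  qed
  have "Max (f ` A) \<in> f ` A" using fin ne by (intro Max_in) auto
  then obtain m where m: "m \<in> A" "f m = Max (f ` A)" by (metis imageE)
  then have arg: "is_arg_max f (\<lambda>x. x \<in> A) m" unfolding is_arg_max_def using fin by (auto simp: not_less)
  then show "\<exists>x. is_arg_max f (\<lambda>x. x \<in> A) x" by blast
  show "is_arg_max f (\<lambda>x. x \<in> A) x \<Longrightarrow> is_arg_min h (\<lambda>x. x \<in> A) x \<and> h x = Min (h ` A)"
    using min by blast
  show "Min (h ` A) = c - int (Max (f ` A))" using min[OF arg] h[OF m(1)] by simp
qed

section \<open>The kernel-type algorithm in a transformed basis\<close>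

locale kernel_type_algorithm = chudnovsky_algorithm K q n g D Q Ps
  for K :: "'f::field set" and q n g D Q Ps +
  fixes BD BDc :: "'f list"
  assumes kernel: "kernel_type K n D Q BD BDc"
begin

sublocale finite_constant_field K
proof (rule finite_constant_field.intro)
  show "subfield K FF" using function_field unfolding function_field_def by blast
  show "finite K" using card_K prime_power by (metis card_ge_0_finite primepow_gt_0_nat)
qed

sublocale Q: function_field_place K Q
  by (intro function_field_place.intro function_field_place_axioms.intro
      finite_constant_field_axioms function_field Q_place)

lemma evaluation_place: "P \<in> set Ps \<Longrightarrow> function_field_place K P"
  using Ps_places
  by (intro function_field_place.intro function_field_place_axioms.intro
      finite_constant_field_axioms function_field) blast

abbreviation "L2D \<equiv> RR K (D + D)"

lemma bases:
  "length BD = n" "is_basis FF K BD (RR K D)"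
  "is_basis FF K BDc {f \<in> L2D. residue Q f = \<zero>\<^bsub>residue_field Q\<^esub>}"
  "is_basis FF K (BD @ BDc) L2D"
  using kernel unfolding kernel_type_def by auto

lemma length_bases: "n + length BDc = length Ps"
  using basis_dim[OF bases(4)] N_eq bases(1) unfolding RR_dim_def by simp

lemma L2D_combination:
  assumes "\<And>i. i \<in> I \<Longrightarrow> c i \<in> K" "\<And>i. i \<in> I \<Longrightarrow> f i \<in> L2D"
  shows "(\<Sum>i\<in>I. c i * f i) \<in> L2D"
proof -
  let ?N = "length (BD @ BDc)"
  have "\<exists>e. (\<forall>k<?N. e k \<in> K) \<and> f i = (\<Sum>k<?N. e k * (BD @ BDc) ! k)" if "i \<in> I" for i
    using assms(2)[OF that] basis_span_iff[OF bases(4)] by blast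
  then obtain e where e: "\<And>i k. i \<in> I \<Longrightarrow> k < ?N \<Longrightarrow> e i k \<in> K"
    "\<And>i. i \<in> I \<Longrightarrow> f i = (\<Sum>k<?N. e i k * (BD @ BDc) ! k)" by metis
  have "(\<Sum>i\<in>I. c i * f i) = (\<Sum>i\<in>I. \<Sum>k<?N. c i * e i k * (BD @ BDc) ! k)"
    using e(2) by (intro sum.cong) (auto simp: sum_distrib_left mult.assoc)
  also have "\<dots> = (\<Sum>k<?N. (\<Sum>i\<in>I. c i * e i k) * (BD @ BDc) ! k)"
    by (subst sum.swap) (simp add: sum_distrib_right)
  finally show ?thesis
    unfolding basis_span_iff[OF bases(4)]
    using assms(1) e(1) by (intro exI[of _ "\<lambda>k. \<Sum>i\<in>I. c i * e i k"]) (auto intro!: K_sum K_closed(5))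
qed

lemma basis_element:
  assumes "is_basis FF K Us E" "i < length Us"
  shows "Us ! i \<in> E"
proof -
  have "Us ! i = (\<Sum>k<length Us. (if k = i then 1 else 0) * Us ! k)"
    using assms(2) by (simp add: if_distrib[of "\<lambda>a. a * _"] cong: if_cong)
  then show ?thesis unfolding basis_span_iff[OF assms(1)]
    using K_closed(1,2) by (intro exI[of _ "\<lambda>k. if k = i then 1 else 0"]) auto
qed

text \<open>
  \<open>P\<close> is not in the support of \<open>D\<close>, so membership in \<open>\<L>(2D)\<close> says that the valuation at \<open>P\<close> is nonnegative.
\<close>

lemma L2D_regular_at_evaluation_place:
  assumes "P \<in> set Ps" "f \<in> L2D"
  shows "f \<in> function_field_place.V P"
proof -
  interpret P: function_field_place K P by (rule evaluation_place[OF assms(1)])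
  show ?thesis
  proof (cases "f = 0")
    case False
    have "place K P" using assms(1) Ps_places by blast
    then have "place_val P f \<ge> - Poly_Mapping.lookup (D + D) P"
      using assms(2) False unfolding RR_def by blast
    moreover have "Poly_Mapping.lookup D P = 0"
      using D_support assms(1) by (auto simp: in_keys_iff)
    ultimately show ?thesis using P.place_val_nonneg_imp[OF False] by (simp add: Poly_Mapping.lookup_add)
  qed (simp add: P.V_closed)
qed

lemma value_at_combination:
  assumes "P \<in> set Ps" "\<And>i. i \<in> I \<Longrightarrow> c i \<in> K" "\<And>i. i \<in> I \<Longrightarrow> f i \<in> L2D"
  shows "value_at K P (\<Sum>i\<in>I. c i * f i) = (\<Sum>i\<in>I. c i * value_at K P (f i))"
proof -
  interpret P: function_field_place K P by (rule evaluation_place[OF assms(1)])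
  show ?thesis
    using assms Ps_places L2D_regular_at_evaluation_place
    by (intro P.value_at_linear_combination) auto
qed

lemma value_at_in_K:
  assumes "P \<in> set Ps" "f \<in> L2D"
  shows "value_at K P f \<in> K"
proof -
  interpret P: function_field_place K P by (rule evaluation_place[OF assms(1)])
  show ?thesis
    using assms Ps_places L2D_regular_at_evaluation_place
    by (intro P.value_at_properties(1)) auto
qed

text \<open>
  In coordinates with respect to \<open>fs\<close>, the matrix acts on vectors over \<open>K\<close> as \<open>Ev\<close> does on \<open>\<L>(2D)\<close>, and
  \<open>Ev\<close> is injective there.
\<close>

lemma mat_inv_eval_mat_carrier:
  assumes len: "length fs = length Ps" and fs: "\<And>j. j < length Ps \<Longrightarrow> fs ! j \<in> L2D"
    and indep: "\<And>c j. \<forall>i<length Ps. c i \<in> K \<Longrightarrow> (\<Sum>i<length Ps. c i * fs ! i) = 0 \<Longrightarrow> j < length Ps \<Longrightarrow> c j = 0"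
  shows "mat_inv (eval_mat K Ps fs) \<in> carrier_mat (length Ps) (length Ps)"
proof -
  let ?N = "length Ps"
  let ?T = "eval_mat K Ps fs"
  let ?KV = "{v \<in> carrier_vec ?N. \<forall>i<?N. v $ i \<in> K}"
  have T: "?T \<in> carrier_mat ?N ?N" using len by (auto simp: eval_mat_def mat_of_cols_def)
  have entry: "?T $$ (i, j) = value_at K (Ps ! i) (fs ! j)" if "i < ?N" "j < ?N" for i j
    using that len by (simp add: eval_mat_def mat_of_cols_def Ev_def)
  have comb: "(\<Sum>j<?N. v $ j * fs ! j) \<in> L2D" if "v \<in> ?KV" for v :: "'f vec"
    using that fs by (intro L2D_combination) auto
  have mult: "?T *\<^sub>v v = Ev K Ps (\<Sum>j<?N. v $ j * fs ! j)" if "v \<in> ?KV" for v :: "'f vec"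
  proof (rule eq_vecI)
    fix i assume "i < dim_vec (Ev K Ps (\<Sum>j<?N. v $ j * fs ! j))"
    then have i: "i < ?N" by (simp add: Ev_def)
    have "(?T *\<^sub>v v) $ i = (\<Sum>j<?N. v $ j * value_at K (Ps ! i) (fs ! j))"
      using that T i by (auto simp: scalar_prod_def entry mult.commute lessThan_atLeast0 intro!: sum.cong)
    also have "\<dots> = value_at K (Ps ! i) (\<Sum>j<?N. v $ j * fs ! j)"
      using that fs i by (intro value_at_combination[symmetric]) auto
    finally show "(?T *\<^sub>v v) $ i = Ev K Ps (\<Sum>j<?N. v $ j * fs ! j) $ i" using i by (simp add: Ev_def)
  qed (use T in \<open>auto simp: Ev_def\<close>)
  show ?thesis
  proof (rule mat_inv_carrier_if_injective[OF T finite_K K_closed(1,2)])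
    fix v :: "'f vec" and i assume "v \<in> carrier_vec ?N" "\<forall>i<?N. v $ i \<in> K" "i < ?N"
    then show "(?T *\<^sub>v v) $ i \<in> K"
      using mult[of v] comb[of v] value_at_in_K[of "Ps ! i"] by (simp add: Ev_def)
  next
    show "inj_on ((*\<^sub>v) ?T) ?KV"
    proof (rule inj_onI)
      fix u v :: "'f vec" assume uv: "u \<in> ?KV" "v \<in> ?KV" "?T *\<^sub>v u = ?T *\<^sub>v v"
      then have "Ev K Ps (\<Sum>j<?N. u $ j * fs ! j) = Ev K Ps (\<Sum>j<?N. v $ j * fs ! j)"
        using mult[OF uv(1)] mult[OF uv(2)] by simp
      then have "(\<Sum>j<?N. u $ j * fs ! j) = (\<Sum>j<?N. v $ j * fs ! j)"
        using inj_onD[OF Ev_Ps_inj] comb uv(1,2) by blast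
      then have sum0: "(\<Sum>j<?N. (u $ j - v $ j) * fs ! j) = 0" by (simp add: left_diff_distrib sum_subtractf)
      have "u $ j - v $ j = 0" if "j < ?N" for j
        using indep[of "\<lambda>j. u $ j - v $ j", OF _ sum0 that] uv(1,2) K_diff by auto
      then show "u = v" using uv(1,2) by (intro eq_vecI) auto
    qed
  qed
qed

context
  fixes \<sigma> :: "'f mat"
  assumes \<sigma>: "\<sigma> \<in> GL K n"
begin

abbreviation "\<sigma>BD \<equiv> transform_basis \<sigma> BD"

lemma \<sigma>_entry: "i < n \<Longrightarrow> j < n \<Longrightarrow> \<sigma> $$ (i, j) \<in> K"
  using \<sigma> elements_matI[of \<sigma> n n i j] unfolding GL_def mats_def by auto

lemma length_\<sigma>BD: "length \<sigma>BD = n"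
  unfolding transform_basis_def using bases(1) by simp

lemma nth_\<sigma>BD: "j < n \<Longrightarrow> \<sigma>BD ! j = (\<Sum>i<n. \<sigma> $$ (i, j) * BD ! i)"
  unfolding transform_basis_def using bases(1) by simp

lemma \<sigma>BD_in_RR: "j < n \<Longrightarrow> \<sigma>BD ! j \<in> RR K D"
  unfolding basis_span_iff[OF bases(2)] nth_\<sigma>BD bases(1)
  using \<sigma>_entry by (intro exI[of _ "\<lambda>i. \<sigma> $$ (i, j)"]) auto

lemma transformed_in_L2D:
  assumes "j < length Ps" shows "(\<sigma>BD @ BDc) ! j \<in> L2D"
proof (cases "j < n")
  case True
  have "BD ! i \<in> L2D" if "i < n" for i
    using basis_element[OF bases(4), of i] that bases(1) by (simp add: nth_append)
  then have "(\<Sum>i<n. \<sigma> $$ (i, j) * BD ! i) \<in> L2D" using \<sigma>_entry True by (intro L2D_combination) auto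
  then show ?thesis using True by (simp add: nth_append length_\<sigma>BD nth_\<sigma>BD)
next
  case False
  then show ?thesis using basis_element[OF bases(4), of j] assms length_bases bases(1)
    by (simp add: nth_append length_\<sigma>BD)
qed

text \<open>
  The coefficients \<open>e\<close> of the same combination with respect to the old basis arise by applying \<open>\<sigma>\<close> to the first \<open>n\<close>
  entries of \<open>c\<close>. They vanish, and \<open>\<sigma>\<close> is invertible.
\<close>

lemma transformed_independent:
  assumes c: "\<forall>i<length Ps. c i \<in> K" and sum0: "(\<Sum>i<length Ps. c i * (\<sigma>BD @ BDc) ! i) = 0"
    and j: "j < length Ps"
  shows "c j = 0"
proof -
  let ?N = "length Ps"
  define e where "e k = (if k < n then (\<Sum>i<n. \<sigma> $$ (k, i) * c i) else c k)" for k
  have eK: "e k \<in> K" if "k < ?N" for k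
    using c \<sigma>_entry length_bases that unfolding e_def by (auto intro!: K_sum K_closed(5))
  have "(\<Sum>k<n. e k * BD ! k) = (\<Sum>k<n. \<Sum>i<n. \<sigma> $$ (k, i) * c i * BD ! k)"
    unfolding e_def by (intro sum.cong) (auto simp: sum_distrib_right)
  also have "\<dots> = (\<Sum>i<n. \<Sum>k<n. c i * (\<sigma> $$ (k, i) * BD ! k))"
    by (subst sum.swap) (simp add: mult_ac)
  also have "\<dots> = (\<Sum>i<n. c i * \<sigma>BD ! i)"
    by (intro sum.cong) (auto simp: nth_\<sigma>BD sum_distrib_left)
  finally have BD: "(\<Sum>k<n. e k * BD ! k) = (\<Sum>i<n. c i * \<sigma>BD ! i)" .
  have "(\<Sum>k<?N. e k * (BD @ BDc) ! k) = (\<Sum>k<n. e k * BD ! k) + (\<Sum>k<length BDc. e (n + k) * BDc ! k)"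
    using sum_append[where us = BD and vs = BDc and c = e] bases(1) length_bases by simp
  also have "\<dots> = (\<Sum>i<n. c i * \<sigma>BD ! i) + (\<Sum>k<length BDc. c (n + k) * BDc ! k)"
    unfolding BD by (simp add: e_def)
  also have "\<dots> = 0"
    using sum0 sum_append[where us = \<sigma>BD and vs = BDc and c = c] length_\<sigma>BD length_bases by simp
  finally have e0: "e k = 0" if "k < ?N" for k
    using basis_independent[OF bases(4), of e k] eK that bases(1) length_bases by simp
  show ?thesis
  proof (cases "j < n")
    case True
    obtain \<tau> where \<tau>: "\<tau> \<in> carrier_mat n n" "\<tau> * \<sigma> = 1\<^sub>m n"
      using \<sigma> unfolding GL_def mats_def by blast
    have \<sigma>c: "\<sigma> \<in> carrier_mat n n" using \<sigma> unfolding GL_def mats_def by blast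
    have "\<sigma> *\<^sub>v vec n c = 0\<^sub>v n"
    proof (rule eq_vecI)
      fix k assume k: "k < dim_vec (0\<^sub>v n :: 'f vec)"
      then have "(\<sigma> *\<^sub>v vec n c) $ k = e k"
        using \<sigma>c by (auto simp: e_def scalar_prod_def lessThan_atLeast0 intro!: sum.cong)
      then show "(\<sigma> *\<^sub>v vec n c) $ k = 0\<^sub>v n $ k" using e0[of k] k length_bases by simp
    qed (use \<sigma>c in auto)
    moreover have "vec n c = \<tau> *\<^sub>v (\<sigma> *\<^sub>v vec n c)"
      using \<tau> \<sigma>c by (simp flip: assoc_mult_mat_vec[of \<tau> n n \<sigma> n])
    moreover have "\<tau> *\<^sub>v 0\<^sub>v n = 0\<^sub>v n" using \<tau>(1) by (intro eq_vecI) auto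
    ultimately have "vec n c = 0\<^sub>v n" by simp
    then show ?thesis using True by (metis index_vec index_zero_vec(1))
  next
    case False
    then show ?thesis using e0[OF j] by (simp add: e_def)
  qed
qed

lemma \<sigma>BD_in_V: "set \<sigma>BD \<subseteq> Q.V"
proof
  fix f assume "f \<in> set \<sigma>BD"
  then obtain j where "j < n" "f = \<sigma>BD ! j" using length_\<sigma>BD by (metis in_set_conv_nth)
  then have "residue Q f \<in> carrier (residue_field Q)" using \<sigma>BD_in_RR Ev_Q_surj by blast
  then show "f \<in> Q.V" using Q.residue_in_carrier_iff by blast
qed

text \<open>
  \<open>coords\<close> is a definite description, so this amounts to independence of \<open>Ev\<^sub>Q(\<sigma>(\<B>\<^sub>D))\<close>. Two coordinate lists of the same class
  differ by the coefficients of a combination \<open>h\<close> of \<open>\<sigma>(\<B>\<^sub>D)\<close> in the kernel of \<open>E\<^sub>Q\<close>. Being also a combination of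
  \<open>\<B>\<^sub>D\<^sup>c\<close>, \<open>h\<close> has only zero coefficients.
\<close>

lemma coords_eqI:
  assumes as: "length as = n" "set as \<subseteq> K" and f: "residue Q f = residue Q (\<Sum>i<n. as ! i * \<sigma>BD ! i)"
  shows "coords K Q (map (residue Q) \<sigma>BD) (residue Q f) = as"
  unfolding coords_def
proof (rule the_equality)
  show "length as = length (map (residue Q) \<sigma>BD) \<and> set as \<subseteq> K \<and>
    ring.combine (residue_field Q) (map (residue Q) as) (map (residue Q) \<sigma>BD) = residue Q f"
    using as f length_\<sigma>BD \<sigma>BD_in_V Q.residue_combine[of as \<sigma>BD] by simp
next
  fix bs assume bs: "length bs = length (map (residue Q) \<sigma>BD) \<and> set bs \<subseteq> K \<and>
    ring.combine (residue_field Q) (map (residue Q) bs) (map (residue Q) \<sigma>BD) = residue Q f"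
  then have len: "length bs = n" and bK: "set bs \<subseteq> K" using length_\<sigma>BD by auto
  define h where "h = (\<Sum>i<n. (as ! i - bs ! i) * \<sigma>BD ! i)"
  have "residue Q (\<Sum>i<n. as ! i * \<sigma>BD ! i) = residue Q (\<Sum>i<n. bs ! i * \<sigma>BD ! i)"
    using bs f Q.residue_combine[of bs \<sigma>BD] \<sigma>BD_in_V length_\<sigma>BD by simp
  then have "h \<in> Q" unfolding h_def Q.residue_eq_iff by (simp add: left_diff_distrib sum_subtractf)
  have diffK: "as ! i - bs ! i \<in> K" if "i < n" for i
    using as bK len that by (metis K_diff nth_mem subsetD)
  have "\<sigma>BD ! i \<in> L2D" if "i < n" for i
    using transformed_in_L2D[of i] that length_bases length_\<sigma>BD by (simp add: nth_append)
  then have "h \<in> L2D" unfolding h_def using diffK by (intro L2D_combination) auto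
  then have "h \<in> {f \<in> L2D. residue Q f = \<zero>\<^bsub>residue_field Q\<^esub>}" using \<open>h \<in> Q\<close> Q.residue_zero_iff by blast
  then obtain e where e: "\<forall>k<length BDc. e k \<in> K" "h = (\<Sum>k<length BDc. e k * BDc ! k)"
    unfolding basis_span_iff[OF bases(3)] by blast
  \<comment> \<open>The relation \<open>h - h = 0\<close>, with the two expressions of \<open>h\<close> placed side by side.\<close>
  define c where "c k = (if k < n then as ! k - bs ! k else - e (k - n))" for k
  have "(\<Sum>k<length Ps. c k * (\<sigma>BD @ BDc) ! k) = 0"
  proof -
    have "(\<Sum>k<length Ps. c k * (\<sigma>BD @ BDc) ! k)
      = (\<Sum>k<n. c k * \<sigma>BD ! k) + (\<Sum>k<length BDc. c (n + k) * BDc ! k)"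
      using sum_append[where us = \<sigma>BD and vs = BDc and c = c] length_\<sigma>BD length_bases by simp
    also have "\<dots> = h - h" unfolding e(2)
      by (simp add: c_def sum_negf flip: e(2) h_def)
    finally show ?thesis by simp
  qed
  moreover have "\<forall>k<length Ps. c k \<in> K"
    using diffK e(1) length_bases K_closed(4) unfolding c_def by auto
  ultimately have "c k = 0" if "k < n" for k
    using transformed_independent[of c k] that length_bases by simp
  then have "as ! k = bs ! k" if "k < n" for k using that unfolding c_def by fastforce
  then show "bs = as" using len as(1) by (intro nth_equalityI) auto
qed

text \<open>
  The first \<open>n\<close> columns belong to the functions whose classes form the basis \<open>\<B>\<^sub>Q\<close>, the others to functions in
  the kernel of \<open>E\<^sub>Q\<close>. So \<open>C\<close> is an identity block followed by a zero block.
\<close>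

lemma residue_mat_entry:
  assumes i: "i < n" and j: "j < length Ps"
  shows "residue_mat K Q (map (residue Q) \<sigma>BD) (\<sigma>BD @ BDc) $$ (i, j) = (if i = j then 1 else 0)"
proof -
  let ?as = "map (\<lambda>i. if i = j then 1 else 0) [0..<n] :: 'f list"
  have sum: "(\<Sum>i<n. ?as ! i * \<sigma>BD ! i) = (if j < n then \<sigma>BD ! j else 0)"
  proof -
    have "(\<Sum>i<n. ?as ! i * \<sigma>BD ! i) = (\<Sum>i<n. if i = j then \<sigma>BD ! i else 0)"
      by (intro sum.cong) auto
    then show ?thesis by simp
  qed
  have "residue Q ((\<sigma>BD @ BDc) ! j) = residue Q (\<Sum>i<n. ?as ! i * \<sigma>BD ! i)"
  proof (cases "j < n")
    case True
    then show ?thesis unfolding sum by (simp add: nth_append length_\<sigma>BD)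
  next
    case False
    have "BDc ! (j - n) \<in> {f \<in> L2D. residue Q f = \<zero>\<^bsub>residue_field Q\<^esub>}"
      using False j length_bases by (intro basis_element[OF bases(3)]) auto
    then have "residue Q (BDc ! (j - n)) = residue Q 0"
      using Q.residue_zero_iff[of 0] Q.P_closed(1) by simp
    then show ?thesis unfolding sum using False by (simp add: nth_append length_\<sigma>BD)
  qed
  then have "coords K Q (map (residue Q) \<sigma>BD) (residue Q ((\<sigma>BD @ BDc) ! j)) = ?as"
    using K_closed(1,2) by (intro coords_eqI) auto
  then show ?thesis
    using i j length_\<sigma>BD length_bases
    by (simp add: residue_mat_def mat_of_cols_def vec_of_list_index nth_map del: map_append)
qed

lemma residue_mat_mult:
  assumes M: "M \<in> carrier_mat (length Ps) m"
  shows "residue_mat K Q (map (residue Q) \<sigma>BD) (\<sigma>BD @ BDc) * M = first_rows n M"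
proof (rule eq_matI)
  let ?C = "residue_mat K Q (map (residue Q) \<sigma>BD) (\<sigma>BD @ BDc)"
  have dim: "dim_row ?C = n" "dim_col ?C = length Ps"
    using length_\<sigma>BD length_bases by (auto simp: residue_mat_def)
  fix i j assume "i < dim_row (first_rows n M)" "j < dim_col (first_rows n M)"
  then have ij: "i < n" "j < m" using M by (auto simp: first_rows_def)
  have "(?C * M) $$ (i, j) = (\<Sum>k<length Ps. ?C $$ (i, k) * M $$ (k, j))"
    using ij dim M by (auto simp: scalar_prod_def lessThan_atLeast0 intro!: sum.cong)
  also have "\<dots> = (\<Sum>k<length Ps. if k = i then M $$ (k, j) else 0)"
    using ij by (intro sum.cong) (auto simp: residue_mat_entry)
  also have "\<dots> = M $$ (i, j)" using ij length_bases by simp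
  finally show "(?C * M) $$ (i, j) = first_rows n M $$ (i, j)" using ij M by (simp add: first_rows_def)
qed (use M length_\<sigma>BD in \<open>auto simp: first_rows_def residue_mat_def\<close>)

lemma mu_transformed_eq:
  "mu_transformed K n g Q Ps BD BDc \<sigma>
    = 3 * int n * (2 * int n + int g - 1) - int (zero_count K n Ps BD BDc \<sigma>)"
proof -
  have "mat_inv (eval_mat K Ps (\<sigma>BD @ BDc)) \<in> carrier_mat (length Ps) (length Ps)"
    using transformed_in_L2D transformed_independent length_\<sigma>BD length_bases
    by (intro mat_inv_eval_mat_carrier) auto
  then show ?thesis
    unfolding mu_transformed_def mu_def mu_A_def mu_R_def zero_count_def
    by (simp add: residue_mat_mult algebra_simps)
qed

end

lemma finite_GL: "finite (GL K n)"
  using finite_mats[OF finite_K] unfolding GL_def by auto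

lemma one_in_GL: "1\<^sub>m n \<in> GL K n"
proof -
  have "1\<^sub>m n \<in> mats K n"
    unfolding mats_def elements_mat_def using K_closed(1,2) by auto
  then show ?thesis unfolding GL_def by (auto intro!: bexI[of _ "1\<^sub>m n"])
qed

end

theorem proposition3p3:
  fixes K :: "'f::field set" and q n g :: nat
    and D :: "'f divisor" and Q :: "'f set" and Ps :: "'f set list"
    and BD BDc :: "'f list"
  assumes "chudnovsky_algorithm K q n g D Q Ps"
    and "kernel_type K n D Q BD BDc"
  shows "(\<exists>\<sigma>. is_arg_max (zero_count K n Ps BD BDc) (\<lambda>\<sigma>. \<sigma> \<in> GL K n) \<sigma>)
    \<and> (\<forall>\<sigma>. is_arg_max (zero_count K n Ps BD BDc) (\<lambda>\<sigma>. \<sigma> \<in> GL K n) \<sigma> \<longrightarrow>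
          is_arg_min (mu_transformed K n g Q Ps BD BDc) (\<lambda>\<sigma>. \<sigma> \<in> GL K n) \<sigma>
          \<and> mu K n g Q Ps (transform_basis \<sigma> BD) BDc (map (residue Q) (transform_basis \<sigma> BD))
              = mu_opti K n g Q Ps BD BDc)
    \<and> mu_opti K n g Q Ps BD BDc
        = 3 * int n * (2 * int n + int g - 1) - int (N_z_max K n Ps BD BDc)"
proof -
  interpret chudnovsky_algorithm K q n g D Q Ps by fact
  interpret kernel_type_algorithm K q n g D Q Ps BD BDc
    by unfold_locales fact
  have "GL K n \<noteq> {}" using one_in_GL by blast
  note compl = argmax_argmin_complement[where h = "mu_transformed K n g Q Ps BD BDc",
      OF finite_GL this mu_transformed_eq]
  show ?thesis
    using compl unfolding mu_opti_def N_z_max_def mu_transformed_def[symmetric] by blast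
qed

end
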